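(* The $\mathbb{F}$-algebra $U^{\vee}_q$ has a presentation by generators $x,X,A$ and relations $$\frac{qAx-q^{-1}xA}{q-q^{-1}} = a^{-1}x^2+a,\qquad \frac{qAX-q^{-1}XA}{q-q^{-1}} = a X^2+a^{-1},$$ $$a^{-1}x^2 -\frac{a^{-1}q-aq^{-1}}{q-q^{-1}}xX-\frac{aq-a^{-1}q^{-1}}{q-q^{-1}}Xx + aX^2 = 0.$$ An isomorphism from this presentation to the presentation of $U^\vee_q$ by generators $x,y^{-1},z$ and relations $$\frac{qy^{-1}x-q^{-1}xy^{-1}}{q-q^{-1}} = y^{-2},\qquad \frac{qzy^{-1}-q^{-1}y^{-1}z}{q-q^{-1}} = y^{-2},\qquad \frac{qzx-q^{-1}xz}{q-q^{-1}} = 1$$ sends $$x \mapsto x,\qquad X \mapsto a^{-2}x + (1-a^{-2})y^{-1},\qquad A \mapsto a^{-1}x+az.$$ The inverse isomorphism sends $$x \mapsto x,\qquad y^{-1} \mapsto \frac{aX-a^{-1}x}{a-a^{-1}},\qquad z \mapsto a^{-1}A-a^{-2}x.$$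
   Context: Algebras are associative with $1$, and a subalgebra has the same $1$ as the parent algebra. $\mathbb{F}$ is a field, $q\in\mathbb{F}$ is nonzero with $q^4\neq 1$, and $a\in\mathbb{F}$ is nonzero with $a^2\neq 1$. $U_q(\mathfrak{sl}_2)$ is the $\mathbb{F}$-algebra with generators $x,y^{\pm1},z$ and relations $yy^{-1}=y^{-1}y=1$, $$\frac{qxy-q^{-1}yx}{q-q^{-1}} = 1,\qquad \frac{qyz-q^{-1}zy}{q-q^{-1}} = 1,\qquad \frac{qzx-q^{-1}xz}{q-q^{-1}} = 1$$ (the equitable presentation). $U^\vee_q$ is the subalgebra of $U_q(\mathfrak{sl}_2)$ generated by $x,y^{-1},z$. In $U^\vee_q$ the elements $X,A$ are $X=a^{-2}x+(1-a^{-2})y^{-1}$ and $A=a^{-1}x+az$. The displayed relations in $x,y^{-1},z$ do give a presentation of $U^\vee_q$. *)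

theory Defs
  imports "HOL-Algebra.QuotRing" "HOL-Algebra.Module" "HOL-Algebra.Subrings" "HOL-Library.Poly_Mapping"
begin

section \<open>Algebras over a field\<close>

text \<open>
  The ground field is a type \<open>'k::field\<close>.  A unital associative algebra over it is carried by the
  record \<^typ>\<open>('k, 'a) module\<close>: a (not necessarily commutative) ring together with a scalar
  multiplication.  (The locale \<open>algebra\<close> of the library is restricted to commutative algebras.)
\<close>

definition alg_iso ::
    "('k::field, 'a, 'm) module_scheme \<Rightarrow> ('k, 'b, 'n) module_scheme \<Rightarrow> ('a \<Rightarrow> 'b) set" where
  "alg_iso A B =
     {h \<in> ring_iso A B. \<forall>c. \<forall>u\<in>carrier A. h (c \<odot>\<^bsub>A\<^esub> u) = c \<odot>\<^bsub>B\<^esub> h u}"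

definition is_subalgebra :: "'a set \<Rightarrow> ('k::field, 'a, 'm) module_scheme \<Rightarrow> bool" where
  "is_subalgebra S A \<longleftrightarrow> subring S A \<and> (\<forall>c. \<forall>u\<in>S. c \<odot>\<^bsub>A\<^esub> u \<in> S)"

definition generated_subalgebra ::
    "('k::field, 'a, 'm) module_scheme \<Rightarrow> 'a set \<Rightarrow> ('k, 'a, 'm) module_scheme" where
  "generated_subalgebra A G = A\<lparr>carrier := \<Inter>{S. is_subalgebra S A \<and> G \<subseteq> S}\<rparr>"

text \<open>The quotient by a two-sided ideal, with the scalar action \<open>c \<odot> (I + u) = I + c \<odot> u\<close>.\<close>

definition quotient_algebra ::
    "('k::field, 'a, 'm) module_scheme \<Rightarrow> 'a set \<Rightarrow> ('k, 'a set) module" where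
  "quotient_algebra A I =
     ring.extend (A Quot I)
       (module.fields (\<lambda>c U. \<Union>u\<in>U. I +>\<^bsub>A\<^esub> (c \<odot>\<^bsub>A\<^esub> u)))"

section \<open>Free algebras and presentations\<close>

text \<open>
  The free monoid on \<open>'g\<close>, written additively so that the convolution product of
  \<^typ>\<open>'b \<Rightarrow>\<^sub>0 'k\<close> becomes the product of noncommutative polynomials.
\<close>

datatype 'g free_monoid = Word "'g list"

instantiation free_monoid :: (type) monoid_add
begin

definition zero_free_monoid :: "'g free_monoid" where
  "zero_free_monoid = Word []"

fun plus_free_monoid :: "'g free_monoid \<Rightarrow> 'g free_monoid \<Rightarrow> 'g free_monoid" where
  "plus_free_monoid (Word u) (Word v) = Word (u @ v)"

instance
proof
  fix u v w :: "'g free_monoid"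
  show "u + v + w = u + (v + w)" by (cases u; cases v; cases w) simp
  show "0 + u = u" by (cases u) (simp add: zero_free_monoid_def)
  show "u + 0 = u" by (cases u) (simp add: zero_free_monoid_def)
qed

end

type_synonym ('k, 'g) ncpoly = "'g free_monoid \<Rightarrow>\<^sub>0 'k"

definition var :: "'g \<Rightarrow> ('k::field, 'g) ncpoly" where
  "var g = Poly_Mapping.single (Word [g]) 1"

definition scale :: "'k::field \<Rightarrow> ('k, 'g) ncpoly \<Rightarrow> ('k, 'g) ncpoly" (infixr \<open>*\<^sub>F\<close> 75) where
  "c *\<^sub>F p = Poly_Mapping.single 0 c * p"

definition free_algebra :: "('k::field, ('k, 'g) ncpoly) module" where
  "free_algebra =
     \<lparr>carrier = UNIV, monoid.mult = (*), one = 1, ring.zero = 0, ring.add = (+), smult = (*\<^sub>F)\<rparr>"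

text \<open>
  A set of relations is a set of pairs \<open>(l, r)\<close>, each standing for \<open>l = r\<close>.  The generators of the
  presented algebra are indexed by the whole type \<open>'g\<close>.
\<close>

definition relation_ideal ::
    "(('k::field, 'g) ncpoly \<times> ('k, 'g) ncpoly) set \<Rightarrow> ('k, 'g) ncpoly set" where
  "relation_ideal R = Idl\<^bsub>free_algebra\<^esub> {l - r | l r. (l, r) \<in> R}"

definition presented_algebra ::
    "(('k::field, 'g) ncpoly \<times> ('k, 'g) ncpoly) set \<Rightarrow> ('k, ('k, 'g) ncpoly set) module" where
  "presented_algebra R = quotient_algebra free_algebra (relation_ideal R)"

definition gen ::
    "(('k::field, 'g) ncpoly \<times> ('k, 'g) ncpoly) set \<Rightarrow> 'g \<Rightarrow> ('k, 'g) ncpoly set" where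
  "gen R g = relation_ideal R +>\<^bsub>free_algebra\<^esub> var g"

text \<open>\<open>has_presentation A \<gamma> R\<close>: the algebra \<open>A\<close> is presented by the generators \<open>\<gamma> g\<close>
  and the relations \<open>R\<close>.\<close>

definition has_presentation ::
    "('k::field, 'a, 'm) module_scheme \<Rightarrow> ('g \<Rightarrow> 'a) \<Rightarrow>
     (('k, 'g) ncpoly \<times> ('k, 'g) ncpoly) set \<Rightarrow> bool" where
  "has_presentation A \<gamma> R \<longleftrightarrow>
     (\<exists>h \<in> alg_iso (presented_algebra R) A. \<forall>g. h (gen R g) = \<gamma> g)"

section \<open>The equitable presentation and its subalgebra\<close>

definition qcomm ::
    "'k::field \<Rightarrow> ('k, 'g) ncpoly \<Rightarrow> ('k, 'g) ncpoly \<Rightarrow> ('k, 'g) ncpoly" where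
  "qcomm q u v = (1 / (q - inverse q)) *\<^sub>F (q *\<^sub>F (u * v) - inverse q *\<^sub>F (v * u))"

datatype equitable_gen = Ux | Uy | Uyinv | Uz

definition Uq_rels ::
    "'k::field \<Rightarrow> (('k, equitable_gen) ncpoly \<times> ('k, equitable_gen) ncpoly) set" where
  "Uq_rels q =
     {(var Uy * var Uyinv, 1),
      (var Uyinv * var Uy, 1),
      (qcomm q (var Ux) (var Uy), 1),
      (qcomm q (var Uy) (var Uz), 1),
      (qcomm q (var Uz) (var Ux), 1)}"

definition Uq :: "'k::field \<Rightarrow> ('k, ('k, equitable_gen) ncpoly set) module" where
  "Uq q = presented_algebra (Uq_rels q)"

definition Uq_vee :: "'k::field \<Rightarrow> ('k, ('k, equitable_gen) ncpoly set) module" where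
  "Uq_vee q = generated_subalgebra (Uq q) (gen (Uq_rels q) ` {Ux, Uyinv, Uz})"

datatype vee_gen = Vx | Vyinv | Vz

definition vee_rels :: "'k::field \<Rightarrow> (('k, vee_gen) ncpoly \<times> ('k, vee_gen) ncpoly) set" where
  "vee_rels q =
     {(qcomm q (var Vyinv) (var Vx), var Vyinv ^ 2),
      (qcomm q (var Vz) (var Vyinv), var Vyinv ^ 2),
      (qcomm q (var Vz) (var Vx), 1)}"

fun vee_elem :: "'k::field \<Rightarrow> vee_gen \<Rightarrow> ('k, equitable_gen) ncpoly set" where
  "vee_elem q Vx = gen (Uq_rels q) Ux"
| "vee_elem q Vyinv = gen (Uq_rels q) Uyinv"
| "vee_elem q Vz = gen (Uq_rels q) Uz"

datatype xXA_gen = Wx | WX | WA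

definition xXA_rels ::
    "'k::field \<Rightarrow> 'k \<Rightarrow> (('k, xXA_gen) ncpoly \<times> ('k, xXA_gen) ncpoly) set" where
  "xXA_rels q a =
     {(qcomm q (var WA) (var Wx), inverse a *\<^sub>F (var Wx ^ 2) + a *\<^sub>F 1),
      (qcomm q (var WA) (var WX), a *\<^sub>F (var WX ^ 2) + inverse a *\<^sub>F 1),
      (inverse a *\<^sub>F (var Wx ^ 2)
         - ((inverse a * q - a * inverse q) / (q - inverse q)) *\<^sub>F (var Wx * var WX)
         - ((a * q - inverse a * inverse q) / (q - inverse q)) *\<^sub>F (var WX * var Wx)
         + a *\<^sub>F (var WX ^ 2), 0)}"

fun xXA_elem :: "'k::field \<Rightarrow> 'k \<Rightarrow> xXA_gen \<Rightarrow> ('k, equitable_gen) ncpoly set" where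
  "xXA_elem q a Wx = vee_elem q Vx"
| "xXA_elem q a WX =
     (inverse a ^ 2 \<odot>\<^bsub>Uq_vee q\<^esub> vee_elem q Vx)
       \<oplus>\<^bsub>Uq_vee q\<^esub> ((1 - inverse a ^ 2) \<odot>\<^bsub>Uq_vee q\<^esub> vee_elem q Vyinv)"
| "xXA_elem q a WA =
     (inverse a \<odot>\<^bsub>Uq_vee q\<^esub> vee_elem q Vx) \<oplus>\<^bsub>Uq_vee q\<^esub> (a \<odot>\<^bsub>Uq_vee q\<^esub> vee_elem q Vz)"

end

theory Submission
  imports Defs "HOL-Library.Function_Algebras"
begin

text \<open>
  The change of variables between \<open>x, X, A\<close> and \<open>x, y\<inverse>, z\<close> is linear, so it is an isomorphism of
  free algebras, and it carries the span of the quadratic relations on one side onto that on the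
  other side.  It remains to show that the relations in \<open>x, y\<inverse>, z\<close> present the subalgebra.  Put
  \<open>w = y\<inverse>\<close>, \<open>e = x - w\<close>, \<open>f = z - w\<close> and \<open>c = q\<^sup>-\<^sup>2\<close>; the relations become
  \<open>w e = c e w\<close>, \<open>f w = c w f\<close> and \<open>f e = c e f + (1 - c) (1 - w\<^sup>2)\<close>.  Hence every element of the
  presented algebra is a combination of the monomials \<open>e\<^sup>i w\<^sup>j f\<^sup>l\<close>.  The same rewriting with \<open>j\<close>
  ranging over the integers defines a representation of the full equitable algebra, in which
  \<open>e\<^sup>i w\<^sup>j f\<^sup>l\<close> maps a fixed vector to the basis vector with index \<open>(i, j, l)\<close>; so the monomials
  remain linearly independent there.
\<close>

section \<open>Free algebras\<close>

lemma ncpoly_single_induct [case_names single add]: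
  fixes p :: "('k::field, 'g) ncpoly"
  assumes "\<And>w c. P (Poly_Mapping.single w c)" and "\<And>p r. P p \<Longrightarrow> P r \<Longrightarrow> P (p + r)"
  shows "P p"
proof (induction p rule: update_induct)
  case const
  then show ?case using assms(1)[of 0 0] by simp
next
  case (update p v d)
  have "Poly_Mapping.update v d p = p + Poly_Mapping.single v d"
    using update by (intro poly_mapping_eqI) (auto simp: lookup_update lookup_add lookup_single when_def in_keys_iff)
  then show ?case using assms update by simp
qed

lemma lookup_scale: "Poly_Mapping.lookup (c *\<^sub>F p) w = c * Poly_Mapping.lookup p w"
proof (induction p rule: ncpoly_single_induct)
  case (single v d)
  then show ?case by (simp add: scale_def mult_single lookup_single when_def)
next
  case (add p r)
  then show ?case by (simp add: scale_def distrib_left lookup_add)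
qed

lemma scale_single: "c *\<^sub>F Poly_Mapping.single w d = Poly_Mapping.single w (c * d)"
  by (simp add: scale_def mult_single)

interpretation ncpoly: vector_space "(*\<^sub>F) :: 'k::field \<Rightarrow> ('k, 'g) ncpoly \<Rightarrow> ('k, 'g) ncpoly"
  by unfold_locales (auto intro!: poly_mapping_eqI simp: lookup_scale lookup_add algebra_simps)

lemma mult_scale_left [simp]: "(c *\<^sub>F p) * r = c *\<^sub>F (p * r)"
  by (simp add: scale_def mult.assoc)

text \<open>Constants are central: the empty word is neutral on both sides and the field is
  commutative.\<close>

lemma mult_scale_right [simp]: "p * (c *\<^sub>F r) = c *\<^sub>F (p * r)"
proof (induction p rule: ncpoly_single_induct)
  case (single w d)
  have "Poly_Mapping.single w d * (Poly_Mapping.single 0 c * r) = Poly_Mapping.single 0 c * (Poly_Mapping.single w d * r)"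
    by (simp add: mult_single mult.commute flip: mult.assoc)
  then show ?case by (simp add: scale_def lookup_single)
qed (simp add: distrib_right ncpoly.scale_right_distrib)

text \<open>Words are built from \<open>1\<close> by multiplying on the left by one generator at a
  time, which is how \<open>foldr\<close> lets a word act.\<close>

lemma ncpoly_induct [case_names one var scale add]:
  fixes p :: "('k::field, 'g) ncpoly"
  assumes one: "P 1" and var: "\<And>g p. P p \<Longrightarrow> P (var g * p)"
    and scale: "\<And>c p. P p \<Longrightarrow> P (c *\<^sub>F p)" and add: "\<And>p r. P p \<Longrightarrow> P r \<Longrightarrow> P (p + r)"
  shows "P p"
proof (induction p rule: ncpoly_single_induct)
  case (single w c)
  have "P (Poly_Mapping.single (Word gs) 1)" for gs
  proof (induction gs)
    case Nil
    then show ?case using one by (simp flip: zero_free_monoid_def)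
  next
    case (Cons g gs)
    have "Poly_Mapping.single (Word (g # gs)) (1::'k) = var g * Poly_Mapping.single (Word gs) 1"
      by (simp add: var_def mult_single)
    then show ?case using var[OF Cons] by simp
  qed
  then have "P (c *\<^sub>F Poly_Mapping.single w 1)" by (cases w) (simp add: scale)
  then show ?case by (simp add: scale_single)
qed (rule add)

subsection \<open>Representations\<close>

text \<open>A module over the free algebra is a vector space with one linear operator per generator,
  subject to no further condition. Two instances follow: left multiplication on polynomials, which
  gives substitutions, and the operators on functions of three indices.\<close>

locale representation = vector_space s
  for s :: "'k::field \<Rightarrow> 'm::ab_group_add \<Rightarrow> 'm" +
  fixes \<rho> :: "'g \<Rightarrow> 'm \<Rightarrow> 'm"
  assumes gen_add: "\<rho> g (m + n) = \<rho> g m + \<rho> g n"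
    and gen_scale: "\<rho> g (s c m) = s c (\<rho> g m)"
begin

fun word_act :: "'g free_monoid \<Rightarrow> 'm \<Rightarrow> 'm" where
  "word_act (Word gs) m = foldr \<rho> gs m"

definition act :: "('k, 'g) ncpoly \<Rightarrow> 'm \<Rightarrow> 'm" where
  "act p m = (\<Sum>w\<in>Poly_Mapping.keys p. s (Poly_Mapping.lookup p w) (word_act w m))"

lemma word_act_add: "word_act w (m + n) = word_act w m + word_act w n"
proof (cases w)
  case (Word gs)
  then show ?thesis by (induction gs arbitrary: w) (auto simp: gen_add)
qed

lemma word_act_scale: "word_act w (s c m) = s c (word_act w m)"
proof (cases w)
  case (Word gs)
  then show ?thesis by (induction gs arbitrary: w) (auto simp: gen_scale)
qed

lemma word_act_plus: "word_act (v + w) m = word_act v (word_act w m)"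
  by (cases v; cases w) simp

text \<open>Sums over the supports of different polynomials are compared by enlarging the index set;
  the added words have coefficient 0.\<close>

lemma act_eq_sum:
  assumes "finite A" and "Poly_Mapping.keys p \<subseteq> A"
  shows "act p m = (\<Sum>w\<in>A. s (Poly_Mapping.lookup p w) (word_act w m))"
  unfolding act_def using assms
  by (intro sum.mono_neutral_left) (auto simp: in_keys_iff)

lemma act_add [simp]: "act (p + r) m = act p m + act r m"
proof -
  let ?A = "Poly_Mapping.keys p \<union> Poly_Mapping.keys r"
  have "Poly_Mapping.keys (p + r) \<subseteq> ?A" by (rule keys_add)
  then show ?thesis
    by (simp add: act_eq_sum[of ?A] lookup_add scale_left_distrib sum.distrib)
qed

lemma act_single: "act (Poly_Mapping.single w c) m = s c (word_act w m)"
  by (subst act_eq_sum[of "{w}"]) auto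

lemma act_zero [simp]: "act 0 m = 0"
  by (simp add: act_def)

lemma act_one [simp]: "act 1 m = m"
proof -
  have "word_act 0 m = m" by (simp add: zero_free_monoid_def)
  then show ?thesis using act_single[of 0 1 m] by simp
qed

lemma act_var [simp]: "act (var g) m = \<rho> g m"
  by (simp add: var_def act_single)

lemma act_scale [simp]: "act (c *\<^sub>F p) m = s c (act p m)"
  by (induction p rule: ncpoly_single_induct)
    (simp_all add: scale_single act_single ncpoly.scale_right_distrib scale_right_distrib)

lemma act_minus [simp]: "act (- p) m = - act p m"
  using act_scale[of "-1" p m] by simp

lemma act_diff [simp]: "act (p - r) m = act p m - act r m"
  using act_add[of p "- r" m] by simp

lemma act_scale_right: "act p (s c m) = s c (act p m)"
  by (induction p rule: ncpoly_single_induct)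
    (simp_all add: act_single word_act_scale scale_right_distrib mult.commute)

lemma act_zero_right [simp]: "act p 0 = 0"
  using act_scale_right[of p 0 0] by simp

text \<open>By bilinearity it is enough to treat two words, whose product is concatenation.\<close>

lemma act_mult [simp]: "act (p * r) m = act p (act r m)"
proof (induction p rule: ncpoly_single_induct)
  case (single w c)
  then show ?case
    by (induction r rule: ncpoly_single_induct)
      (simp_all add: mult_single act_single word_act_plus word_act_scale word_act_add
        distrib_left scale_right_distrib)
qed (simp add: distrib_right)

end

subsection \<open>Substitution homomorphisms\<close>

interpretation left_mult: representation "(*\<^sub>F)" "\<lambda>g m. \<theta> g * m"
  for \<theta> :: "'g \<Rightarrow> ('k::field, 'h) ncpoly"
  by unfold_locales (simp_all add: distrib_left)

text \<open>The evaluation homomorphism is the orbit map of \<open>1\<close> when each generator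
  acts by left multiplication by its image; multiplicativity is then inherited from
  \<open>act_mult\<close>.\<close>

definition subst :: "('g \<Rightarrow> ('k::field, 'h) ncpoly) \<Rightarrow> ('k, 'g) ncpoly \<Rightarrow> ('k, 'h) ncpoly" where
  "subst \<theta> p = left_mult.act \<theta> p 1"

lemma left_mult_act: "left_mult.act \<theta> p m = subst \<theta> p * m"
  by (induction p rule: ncpoly_induct) (simp_all add: subst_def distrib_right mult.assoc)

lemma subst_simps [simp]:
  "subst \<theta> 0 = 0" "subst \<theta> 1 = 1" "subst \<theta> (var g) = \<theta> g"
  "subst \<theta> (p + r) = subst \<theta> p + subst \<theta> r" "subst \<theta> (p - r) = subst \<theta> p - subst \<theta> r"
  "subst \<theta> (- p) = - subst \<theta> p" "subst \<theta> (c *\<^sub>F p) = c *\<^sub>F subst \<theta> p"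
  by (simp_all add: subst_def)

lemma subst_mult [simp]: "subst \<theta> (p * r) = subst \<theta> p * subst \<theta> r"
proof -
  have "subst \<theta> (p * r) = left_mult.act \<theta> p (subst \<theta> r)"
    unfolding subst_def by (rule left_mult.act_mult)
  then show ?thesis by (rule trans) (rule left_mult_act)
qed

lemma subst_power [simp]: "subst \<theta> (p ^ n) = subst \<theta> p ^ n"
  by (induction n) simp_all

lemma subst_qcomm [simp]: "subst \<theta> (qcomm q p r) = qcomm q (subst \<theta> p) (subst \<theta> r)"
  by (simp add: qcomm_def)

lemma subst_subst: "subst \<theta> (subst \<eta> p) = subst (\<lambda>g. subst \<theta> (\<eta> g)) p"
  by (induction p rule: ncpoly_induct) simp_all

lemma subst_var: "subst var p = p"
  by (induction p rule: ncpoly_induct) simp_all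

section \<open>Presented algebras\<close>

lemma free_algebra_sel [simp]:
  "carrier free_algebra = UNIV" "x \<otimes>\<^bsub>free_algebra\<^esub> y = x * y" "\<one>\<^bsub>free_algebra\<^esub> = 1"
  "\<zero>\<^bsub>free_algebra\<^esub> = 0" "x \<oplus>\<^bsub>free_algebra\<^esub> y = x + y" "c \<odot>\<^bsub>free_algebra\<^esub> x = c *\<^sub>F x"
  by (simp_all add: free_algebra_def)

lemma ring_free_algebra: "ring (free_algebra :: ('k::field, ('k, 'g) ncpoly) module)"
proof (rule ringI)
  show "abelian_group (free_algebra :: ('k::field, ('k, 'g) ncpoly) module)"
    by (rule abelian_groupI) (auto simp: add.assoc add.commute intro: exI[of _ "- x" for x])
  show "Group.monoid (free_algebra :: ('k::field, ('k, 'g) ncpoly) module)"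
    by (rule monoidI) (auto simp: mult.assoc)
qed (auto simp: algebra_simps)

interpretation free: ring "free_algebra :: ('k::field, ('k, 'g) ncpoly) module"
  by (rule ring_free_algebra)

lemma a_inv_free_algebra [simp]: "\<ominus>\<^bsub>free_algebra\<^esub> x = - x"
  by (rule free.minus_equality) auto

lemma ideal_relation_ideal: "ideal (relation_ideal R) free_algebra"
  unfolding relation_ideal_def by (rule free.genideal_ideal) simp

lemma relation_ideal_zero: "0 \<in> relation_ideal R"
  using additive_subgroup.zero_closed[OF ideal.axioms(1)[OF ideal_relation_ideal]] by simp

lemma relation_ideal_add: "p \<in> relation_ideal R \<Longrightarrow> r \<in> relation_ideal R \<Longrightarrow> p + r \<in> relation_ideal R"
  using additive_subgroup.a_closed[OF ideal.axioms(1)[OF ideal_relation_ideal]] by simp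

lemma relation_ideal_mult_left: "p \<in> relation_ideal R \<Longrightarrow> r * p \<in> relation_ideal R"
  using ideal.I_l_closed[OF ideal_relation_ideal, of p R r] by simp

lemma relation_ideal_mult_right: "p \<in> relation_ideal R \<Longrightarrow> p * r \<in> relation_ideal R"
  using ideal.I_r_closed[OF ideal_relation_ideal, of p R r] by simp

lemma relation_ideal_scale: "p \<in> relation_ideal R \<Longrightarrow> c *\<^sub>F p \<in> relation_ideal R"
  unfolding scale_def by (rule relation_ideal_mult_left)

lemma relation_ideal_uminus: "p \<in> relation_ideal R \<Longrightarrow> - p \<in> relation_ideal R"
  using relation_ideal_mult_left[of p R "-1"] by simp

lemma relation_ideal_diff: "p \<in> relation_ideal R \<Longrightarrow> r \<in> relation_ideal R \<Longrightarrow> p - r \<in> relation_ideal R"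
  using relation_ideal_add[of p R "- r"] relation_ideal_uminus[of r R] by simp

lemmas relation_ideal_closed = relation_ideal_zero relation_ideal_add relation_ideal_mult_left
  relation_ideal_mult_right relation_ideal_scale relation_ideal_uminus relation_ideal_diff

lemma relation_idealI: "(l, r) \<in> R \<Longrightarrow> l - r \<in> relation_ideal R"
  unfolding relation_ideal_def by (rule subsetD[OF free.genideal_self]) auto

text \<open>An induction principle for the ideal; closure under negation comes from multiplying by
  \<open>-1\<close>.\<close>

lemma relation_ideal_least:
  assumes "p \<in> relation_ideal R" and "\<And>l r. (l, r) \<in> R \<Longrightarrow> l - r \<in> J" and "0 \<in> J"
    and "\<And>u v. u \<in> J \<Longrightarrow> v \<in> J \<Longrightarrow> u + v \<in> J"
    and "\<And>u v. u \<in> J \<Longrightarrow> v * u \<in> J" and "\<And>u v. u \<in> J \<Longrightarrow> u * v \<in> J"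
  shows "p \<in> J"
proof -
  have minus: "- u \<in> J" if "u \<in> J" for u
    using assms(5)[OF that, of "-1"] by simp
  have "ideal J free_algebra"
  proof (rule idealI)
    show "subgroup J (add_monoid free_algebra)"
      by (rule free.add.subgroupI) (use assms minus in \<open>auto simp flip: a_inv_def\<close>)
  qed (use assms in \<open>auto simp: ring_free_algebra\<close>)
  then have "relation_ideal R \<subseteq> J"
    unfolding relation_ideal_def using assms(2) by (intro free.genideal_minimal) auto
  then show ?thesis using assms(1) by blast
qed

section \<open>Cosets of polynomials and their arithmetic\<close>

definition cls :: "(('k::field, 'g) ncpoly \<times> ('k, 'g) ncpoly) set \<Rightarrow> ('k, 'g) ncpoly \<Rightarrow> ('k, 'g) ncpoly set" where
  "cls R p = relation_ideal R +>\<^bsub>free_algebra\<^esub> p"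

lemma gen_eq_cls: "gen R g = cls R (var g)"
  by (simp add: gen_def cls_def)

lemma cls_eq_iff: "cls R p = cls R r \<longleftrightarrow> p - r \<in> relation_ideal R"
proof -
  have "p - r = p \<ominus>\<^bsub>free_algebra\<^esub> r" by (simp add: a_minus_def)
  then show ?thesis
    using free.quotient_eq_iff_same_a_r_cos[OF ideal_relation_ideal]
    by (metis UNIV_I cls_def free_algebra_sel(1))
qed

lemma mem_cls_iff: "r \<in> cls R p \<longleftrightarrow> r - p \<in> relation_ideal R"
  unfolding cls_def a_r_coset_def' by (auto simp: algebra_simps intro!: bexI[of _ "r - p"])

lemma presented_algebra_sel:
  "carrier (presented_algebra R) = range (cls R)"
  "cls R p \<otimes>\<^bsub>presented_algebra R\<^esub> cls R r = cls R (p * r)"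
  "\<one>\<^bsub>presented_algebra R\<^esub> = cls R 1"
  "\<zero>\<^bsub>presented_algebra R\<^esub> = cls R 0"
  "cls R p \<oplus>\<^bsub>presented_algebra R\<^esub> cls R r = cls R (p + r)"
  "c \<odot>\<^bsub>presented_algebra R\<^esub> cls R p = cls R (c *\<^sub>F p)"
proof -
  show "carrier (presented_algebra R) = range (cls R)"
    by (auto simp: presented_algebra_def quotient_algebra_def ring.defs module.defs FactRing_def A_RCOSETS_def' cls_def)
  show "cls R p \<otimes>\<^bsub>presented_algebra R\<^esub> cls R r = cls R (p * r)"
    using ideal.rcoset_mult_add[OF ideal_relation_ideal, of p r R]
    by (simp add: presented_algebra_def quotient_algebra_def ring.defs module.defs FactRing_def cls_def)
  show "\<one>\<^bsub>presented_algebra R\<^esub> = cls R 1"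
    by (simp add: presented_algebra_def quotient_algebra_def ring.defs module.defs FactRing_def cls_def)
  show "\<zero>\<^bsub>presented_algebra R\<^esub> = cls R 0"
    by (auto simp add: presented_algebra_def quotient_algebra_def ring.defs module.defs FactRing_def mem_cls_iff)
  show "cls R p \<oplus>\<^bsub>presented_algebra R\<^esub> cls R r = cls R (p + r)"
    using abelian_subgroup.a_rcos_sum[OF abelian_subgroupI3[OF
      ideal.axioms(1)[OF ideal_relation_ideal] free.is_abelian_group], of p r]
    by (simp add: presented_algebra_def quotient_algebra_def ring.defs module.defs FactRing_def cls_def)
  \<comment> \<open>The scalar action is a union over all representatives. Their multiples differ by
    ideal elements, so the cosets coincide, and \<open>p\<close> itself shows that the union is not
    empty.\<close>
  have "(\<Union>u\<in>cls R p. cls R (c *\<^sub>F u)) = cls R (c *\<^sub>F p)"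
  proof -
    have "cls R (c *\<^sub>F u) = cls R (c *\<^sub>F p)" if "u \<in> cls R p" for u
      using relation_ideal_scale[of "u - p" R c] that
      by (simp add: mem_cls_iff cls_eq_iff ncpoly.scale_right_diff_distrib)
    moreover have "p \<in> cls R p" by (simp add: mem_cls_iff relation_ideal_zero)
    ultimately show ?thesis by blast
  qed
  then show "c \<odot>\<^bsub>presented_algebra R\<^esub> cls R p = cls R (c *\<^sub>F p)"
    by (simp add: presented_algebra_def quotient_algebra_def ring.defs module.defs cls_def)
qed

lemma ring_presented_algebra: "ring (presented_algebra R)"
proof (rule ringI)
  show "abelian_group (presented_algebra R)"
  proof (rule abelian_groupI)
    fix x assume "x \<in> carrier (presented_algebra R)"
    then obtain p where "x = cls R p" by (auto simp: presented_algebra_sel)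
    then show "\<exists>y\<in>carrier (presented_algebra R). y \<oplus>\<^bsub>presented_algebra R\<^esub> x = \<zero>\<^bsub>presented_algebra R\<^esub>"
      by (intro bexI[of _ "cls R (- p)"]) (auto simp: presented_algebra_sel)
  qed (auto simp: presented_algebra_sel add.assoc add.commute add.left_commute)
  show "Group.monoid (presented_algebra R)"
    by (rule monoidI) (auto simp: presented_algebra_sel mult.assoc)
qed (auto simp: presented_algebra_sel distrib_left distrib_right)

interpretation presented: ring "presented_algebra R" for R
  by (rule ring_presented_algebra)

lemma presented_algebra_a_inv: "\<ominus>\<^bsub>presented_algebra R\<^esub> cls R p = cls R (- p)"
  by (rule presented.minus_equality) (auto simp: presented_algebra_sel)

lemma presented_algebra_minus: "cls R p \<ominus>\<^bsub>presented_algebra R\<^esub> cls R r = cls R (p - r)"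
  by (simp add: a_minus_def presented_algebra_a_inv presented_algebra_sel)

lemma cls_add_cong: "cls R p = cls R p' \<Longrightarrow> cls R r = cls R r' \<Longrightarrow> cls R (p + r) = cls R (p' + r')"
  using presented_algebra_sel(5)[of R] by metis

lemma cls_mult_cong: "cls R p = cls R p' \<Longrightarrow> cls R r = cls R r' \<Longrightarrow> cls R (p * r) = cls R (p' * r')"
  using presented_algebra_sel(2)[of R] by metis

lemma cls_scale_cong: "cls R p = cls R p' \<Longrightarrow> cls R (c *\<^sub>F p) = cls R (c *\<^sub>F p')"
  using presented_algebra_sel(6)[of R] by metis

lemma cls_diff_cong: "cls R p = cls R p' \<Longrightarrow> cls R r = cls R r' \<Longrightarrow> cls R (p - r) = cls R (p' - r')"
  using presented_algebra_minus[of R] by metis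

section \<open>Homomorphisms induced by substitutions\<close>

text \<open>The union over representatives avoids a choice; once the substitution respects the
  relations, all cosets in the union agree and this is the induced homomorphism.\<close>

definition lift ::
    "(('k::field, 'h) ncpoly \<times> ('k, 'h) ncpoly) set \<Rightarrow> ('g \<Rightarrow> ('k, 'h) ncpoly) \<Rightarrow>
      ('k, 'g) ncpoly set \<Rightarrow> ('k, 'h) ncpoly set" where
  "lift R' \<theta> C = (\<Union>p\<in>C. cls R' (subst \<theta> p))"

definition maps_relations ::
    "(('k::field, 'g) ncpoly \<times> ('k, 'g) ncpoly) set \<Rightarrow> (('k, 'h) ncpoly \<times> ('k, 'h) ncpoly) set \<Rightarrow>
      ('g \<Rightarrow> ('k, 'h) ncpoly) \<Rightarrow> bool" where
  "maps_relations R R' \<theta> \<longleftrightarrow> (\<forall>(l, r)\<in>R. subst \<theta> (l - r) \<in> relation_ideal R')"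

text \<open>The preimage of an ideal under a substitution is an ideal, so it contains the whole
  relation ideal as soon as it contains the relators.\<close>

lemma maps_relations_ideal:
  assumes "maps_relations R R' \<theta>" and "p \<in> relation_ideal R"
  shows "subst \<theta> p \<in> relation_ideal R'"
proof -
  have "p \<in> {u. subst \<theta> u \<in> relation_ideal R'}"
    using assms(2) by (rule relation_ideal_least)
      (use assms(1) in \<open>auto simp: maps_relations_def relation_ideal_closed\<close>)
  then show ?thesis by simp
qed

lemma lift_cls:
  assumes "maps_relations R R' \<theta>"
  shows "lift R' \<theta> (cls R p) = cls R' (subst \<theta> p)"
proof -
  have "cls R' (subst \<theta> u) = cls R' (subst \<theta> p)" if "u \<in> cls R p" for u
    using maps_relations_ideal[OF assms, of "u - p"] that by (simp add: mem_cls_iff cls_eq_iff)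
  moreover have "p \<in> cls R p" by (simp add: mem_cls_iff relation_ideal_zero)
  ultimately show ?thesis unfolding lift_def by blast
qed

text \<open>Restricting the carrier lets one statement serve isomorphisms onto a subalgebra as well
  as onto the whole algebra. Injectivity is stated on polynomials: only elements of the source ideal
  become zero.\<close>

lemma lift_alg_iso:
  assumes "maps_relations R R' \<theta>"
    and inj: "\<And>p. subst \<theta> p \<in> relation_ideal R' \<Longrightarrow> p \<in> relation_ideal R"
    and B: "B = range (\<lambda>p. cls R' (subst \<theta> p))"
  shows "lift R' \<theta> \<in> alg_iso (presented_algebra R) (presented_algebra R'\<lparr>carrier := B\<rparr>)"
  unfolding alg_iso_def
proof (intro CollectI conjI allI ballI ring_iso_memI)
  have "inj_on (lift R' \<theta>) (range (cls R))"
  proof (rule inj_onI, clarify)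
    fix p r assume "lift R' \<theta> (cls R p) = lift R' \<theta> (cls R r)"
    then show "cls R p = cls R r"
      using inj[of "p - r"] by (simp add: lift_cls[OF assms(1)] cls_eq_iff)
  qed
  moreover have "lift R' \<theta> ` range (cls R) = B"
    by (auto simp: B lift_cls[OF assms(1)] image_image)
  ultimately show "bij_betw (lift R' \<theta>) (carrier (presented_algebra R))
      (carrier (presented_algebra R'\<lparr>carrier := B\<rparr>))"
    by (simp add: bij_betw_def presented_algebra_sel)
qed (auto simp: B lift_cls[OF assms(1)] presented_algebra_sel)

lemma alg_iso_trans:
  assumes "f \<in> alg_iso A B" and "h \<in> alg_iso B C"
  shows "h \<circ> f \<in> alg_iso A C"
  using assms unfolding alg_iso_def ring_iso_def
  by (auto simp: bij_betw_trans intro: ring_hom_trans dest: ring_hom_closed)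

lemma lift_mutual_inverse:
  assumes "maps_relations R R' \<theta>" and "maps_relations R' R \<eta>" and "\<And>g. subst \<eta> (\<theta> g) = var g"
    and "C \<in> carrier (presented_algebra R)"
  shows "lift R \<eta> (lift R' \<theta> C) = C"
  using assms by (auto simp: presented_algebra_sel lift_cls subst_subst subst_var)

text \<open>If the image of \<open>p\<close> lies in the target ideal, the inverse substitution
  carries it back to \<open>p\<close> and into the source ideal; this is injectivity.\<close>

lemma lift_alg_iso_of_inverse:
  assumes "maps_relations R R' \<theta>" and "maps_relations R' R \<eta>"
    and "\<And>g. subst \<eta> (\<theta> g) = var g" and "\<And>h. subst \<theta> (\<eta> h) = var h"
  shows "lift R' \<theta> \<in> alg_iso (presented_algebra R) (presented_algebra R')"
proof -
  have *: "subst \<eta> (subst \<theta> p) = p" "subst \<theta> (subst \<eta> r) = r" for p r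
    by (simp_all add: assms(3,4) subst_subst subst_var)
  have inj: "p \<in> relation_ideal R" if "subst \<theta> p \<in> relation_ideal R'" for p
    using maps_relations_ideal[OF assms(2) that] by (simp only: *)
  have "range (\<lambda>p. cls R' (subst \<theta> p)) = range (cls R')"
    using *(2) by (metis surj_def image_image)
  then have "carrier (presented_algebra R') = range (\<lambda>p. cls R' (subst \<theta> p))"
    by (simp add: presented_algebra_sel)
  from lift_alg_iso[OF assms(1) inj this] show ?thesis by simp
qed

text \<open>The image of the substitution is a subalgebra containing \<open>G\<close>; conversely,
  induction on polynomials builds each of its elements from \<open>G\<close> inside any such
  subalgebra.\<close>

lemma generated_subalgebra_presented:
  assumes G: "G = (\<lambda>g. cls R (\<theta> g)) ` UNIV"
  shows "generated_subalgebra (presented_algebra R) G =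
    presented_algebra R\<lparr>carrier := range (\<lambda>p. cls R (subst \<theta> p))\<rparr>"
proof -
  let ?A = "presented_algebra R" and ?B = "range (\<lambda>p. cls R (subst \<theta> p))"
  have sel: "cls R (subst \<theta> p) \<oplus>\<^bsub>?A\<^esub> cls R (subst \<theta> r) = cls R (subst \<theta> (p + r))"
    "cls R (subst \<theta> p) \<otimes>\<^bsub>?A\<^esub> cls R (subst \<theta> r) = cls R (subst \<theta> (p * r))"
    "c \<odot>\<^bsub>?A\<^esub> cls R (subst \<theta> p) = cls R (subst \<theta> (c *\<^sub>F p))"
    "\<ominus>\<^bsub>?A\<^esub> cls R (subst \<theta> p) = cls R (subst \<theta> (- p))"
    "\<one>\<^bsub>?A\<^esub> = cls R (subst \<theta> 1)" for p r c
    by (simp_all add: presented_algebra_sel presented_algebra_a_inv)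
  have "subring ?B ?A"
    by (rule presented.subringI) (auto simp: sel presented_algebra_sel(1) simp del: subst_simps subst_mult)
  moreover have "G \<subseteq> ?B"
    using subst_simps(3)[of \<theta>] unfolding G by (metis image_subset_iff rangeI)
  ultimately have "is_subalgebra ?B ?A \<and> G \<subseteq> ?B"
    by (auto simp: is_subalgebra_def sel(3) simp del: subst_simps)
  moreover have "?B \<subseteq> S" if S: "is_subalgebra S ?A" "G \<subseteq> S" for S
  proof -
    note sub = subringE[OF S(1)[unfolded is_subalgebra_def, THEN conjunct1]]
    have "cls R (subst \<theta> p) \<in> S" for p
    proof (induction p rule: ncpoly_induct)
      case one
      then show ?case using sub(3) by (simp add: sel(5))
    next
      case (var g p)
      have "cls R (subst \<theta> (var g)) \<in> S" using S(2) by (auto simp: G)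
      then show ?case using sub(6)[OF _ var] by (metis sel(2) subst_mult)
    next
      case (scale c p)
      then show ?case using S(1) by (auto simp: is_subalgebra_def sel(3)[symmetric] simp del: subst_simps)
    next
      case (add p r)
      then show ?case using sub(7) by (simp only: sel(1)[symmetric])
    qed
    then show ?thesis by auto
  qed
  ultimately have "\<Inter>{S. is_subalgebra S ?A \<and> G \<subseteq> S} = ?B" by blast
  then show ?thesis by (simp add: generated_subalgebra_def)
qed

section \<open>A change of variables\<close>

fun to_vee :: "'k::field \<Rightarrow> xXA_gen \<Rightarrow> ('k, vee_gen) ncpoly" where
  "to_vee a Wx = var Vx"
| "to_vee a WX = inverse a ^ 2 *\<^sub>F var Vx + (1 - inverse a ^ 2) *\<^sub>F var Vyinv"
| "to_vee a WA = inverse a *\<^sub>F var Vx + a *\<^sub>F var Vz"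

fun from_vee :: "'k::field \<Rightarrow> vee_gen \<Rightarrow> ('k, xXA_gen) ncpoly" where
  "from_vee a Vx = var Wx"
| "from_vee a Vyinv = (1 / (a - inverse a)) *\<^sub>F (a *\<^sub>F var WX - inverse a *\<^sub>F var Wx)"
| "from_vee a Vz = inverse a *\<^sub>F var WA - inverse a ^ 2 *\<^sub>F var Wx"

text \<open>Serves for \<open>a\<close>, where it makes the inverse of y recoverable from x and X,
  and for \<open>q\<close>, where it is the denominator in the relations.\<close>

lemma inverse_neq_self: "(a::'k::field) \<noteq> 0 \<Longrightarrow> a ^ 2 \<noteq> 1 \<Longrightarrow> a - inverse a \<noteq> 0"
  by (auto simp: power2_eq_square field_simps)

lemma subst_from_to:
  assumes "a \<noteq> 0" and "a ^ 2 \<noteq> 1"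
  shows "subst (from_vee a) (to_vee a g) = var g"
proof (cases g)
  case WX
  have a: "a - inverse a \<noteq> 0" using assms by (rule inverse_neq_self)
  have "(1 - inverse a ^ 2) * (1 / (a - inverse a)) = inverse a"
    using a assms(1) by (simp add: field_simps power2_eq_square)
  then have "(1 - inverse a ^ 2) *\<^sub>F from_vee a Vyinv = inverse a *\<^sub>F (a *\<^sub>F var WX - inverse a *\<^sub>F var Wx)"
    by (simp only: from_vee.simps ncpoly.scale_scale)
  then show ?thesis using WX assms(1)
    by (simp add: ncpoly.scale_right_diff_distrib power2_eq_square del: from_vee.simps(2))
next
  case WA
  then show ?thesis using assms(1)
    by (simp add: ncpoly.scale_right_diff_distrib power2_eq_square field_simps)
qed simp

lemma subst_to_from:
  assumes "a \<noteq> 0" and "a ^ 2 \<noteq> 1"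
  shows "subst (to_vee a) (from_vee a g) = var g"
proof (cases g)
  case Vyinv
  have a: "a - inverse a \<noteq> 0" using assms by (rule inverse_neq_self)
  have "1 / (a - inverse a) * (a * (1 - inverse a ^ 2)) = 1"
    using a assms(1) by (simp add: field_simps power2_eq_square)
  moreover have "a *\<^sub>F to_vee a WX - inverse a *\<^sub>F to_vee a Wx = (a * (1 - inverse a ^ 2)) *\<^sub>F var Vyinv"
    using assms(1) by (simp add: ncpoly.scale_right_distrib power2_eq_square)
  ultimately show ?thesis using Vyinv by (simp del: to_vee.simps)
next
  case Vz
  then show ?thesis using assms(1)
    by (simp add: ncpoly.scale_right_distrib power2_eq_square field_simps)
qed simp

section \<open>The quadratic relations under the change of variables\<close>

text \<open>Method for the identities below: the difference is expanded over words of length two,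
  and each scalar coefficient then vanishes by field arithmetic.\<close>

lemma equal_by_coefficients:
  fixes p r t :: "('k::field, 'g) ncpoly"
  shows "p - r = t \<Longrightarrow> t = 0 \<Longrightarrow> p = r"
  by simp

text \<open>Here \<open>p\<close>, \<open>s\<close>, \<open>b\<close> stand for
  \<open>inverse q\<close>, \<open>1 / (q - inverse q)\<close>, \<open>inverse a\<close>, so that
  only polynomial identities between scalars remain. The multipliers on the right can be read off:
  \<open>z * x\<close> forces \<open>b\<close>, \<open>z * w\<close> forces \<open>a - b\<close>,
  and \<open>w * x\<close> gives the last one.\<close>

lemma xXA_relation_2:
  fixes x w z :: "('k::field, 'g) ncpoly"
  assumes "s * (q - p) = 1" and "a * b = 1" and "B = b ^ 2" and "d = 1 - b ^ 2"
  shows "s *\<^sub>F (q *\<^sub>F ((b *\<^sub>F x + a *\<^sub>F z) * (B *\<^sub>F x + d *\<^sub>F w)) -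
      p *\<^sub>F ((B *\<^sub>F x + d *\<^sub>F w) * (b *\<^sub>F x + a *\<^sub>F z))) -
      (a *\<^sub>F (B *\<^sub>F x + d *\<^sub>F w) ^ 2 + b *\<^sub>F 1) =
    b *\<^sub>F (s *\<^sub>F (q *\<^sub>F (z * x) - p *\<^sub>F (x * z)) - 1) +
    (a - b) *\<^sub>F (s *\<^sub>F (q *\<^sub>F (z * w) - p *\<^sub>F (w * z)) - w ^ 2) -
    (b * d) *\<^sub>F (s *\<^sub>F (q *\<^sub>F (w * x) - p *\<^sub>F (x * w)) - w ^ 2)"
proof (rule equal_by_coefficients)
  show "s *\<^sub>F (q *\<^sub>F ((b *\<^sub>F x + a *\<^sub>F z) * (B *\<^sub>F x + d *\<^sub>F w)) -
      p *\<^sub>F ((B *\<^sub>F x + d *\<^sub>F w) * (b *\<^sub>F x + a *\<^sub>F z))) -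
      (a *\<^sub>F (B *\<^sub>F x + d *\<^sub>F w) ^ 2 + b *\<^sub>F 1) -
    (b *\<^sub>F (s *\<^sub>F (q *\<^sub>F (z * x) - p *\<^sub>F (x * z)) - 1) +
    (a - b) *\<^sub>F (s *\<^sub>F (q *\<^sub>F (z * w) - p *\<^sub>F (w * z)) - w ^ 2) -
    (b * d) *\<^sub>F (s *\<^sub>F (q *\<^sub>F (w * x) - p *\<^sub>F (x * w)) - w ^ 2)) =
    (s * (q - p) * b * B - a * B * B) *\<^sub>F (x * x) +
    (s * q * b * d - a * B * d - b * d * s * p) *\<^sub>F (x * w) +
    (b * d * s * q - a * B * d - s * p * d * b) *\<^sub>F (w * x) +
    (a - b - b * d - a * d * d) *\<^sub>F (w * w) +
    (s * q * a * B - b * s * q) *\<^sub>F (z * x) + (b * s * p - s * p * a * B) *\<^sub>F (x * z) +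
    (s * q * a * d - (a - b) * s * q) *\<^sub>F (z * w) +
    ((a - b) * s * p - s * p * a * d) *\<^sub>F (w * z)"
    by (simp add: algebra_simps power2_eq_square)
  \<comment> \<open>The identities \<open>a * B = b\<close> and \<open>a * d = a - b\<close>,
    together with \<open>s * (q - p) = 1\<close>, make all eight coefficients vanish.\<close>
  have aB: "a * B = b" using assms(2,3) by (simp add: power2_eq_square flip: mult.assoc)
  have ad: "a * d = a - b" using aB assms(3,4) by (simp add: right_diff_distrib)
  have c0: "s * (q - p) * b * B - a * B * B = 0"
    using assms(1) by (simp add: aB ad)
  have "s * q * b * d - a * B * d - b * d * s * p = b * d * (s * (q - p)) - a * B * d"
    by (simp add: algebra_simps)
  then have c1: "s * q * b * d - a * B * d - b * d * s * p = 0"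
    by (simp add: assms(1) aB ad)
  have "b * d * s * q - a * B * d - s * p * d * b = b * d * (s * (q - p)) - a * B * d"
    by (simp add: algebra_simps)
  then have c2: "b * d * s * q - a * B * d - s * p * d * b = 0"
    by (simp add: assms(1) aB ad)
  have "a - b - b * d - a * d * d = a - b - b * d - (a - b) * d"
    by (simp add: ad)
  also have "\<dots> = a - b - a * d"
    by (simp add: algebra_simps)
  finally have c3: "a - b - b * d - a * d * d = 0"
    by (simp add: assms(1) aB ad)
  have "s * q * a * B - b * s * q = s * q * (a * B - b)"
    by (simp add: algebra_simps)
  then have c4: "s * q * a * B - b * s * q = 0"
    by (simp add: assms(1) aB ad)
  have "b * s * p - s * p * a * B = s * p * (b - a * B)"
    by (simp add: algebra_simps)
  then have c5: "b * s * p - s * p * a * B = 0"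
    by (simp add: assms(1) aB ad)
  have "s * q * a * d - (a - b) * s * q = s * q * (a * d - (a - b))"
    by (simp add: algebra_simps)
  then have c6: "s * q * a * d - (a - b) * s * q = 0"
    by (simp add: assms(1) aB ad)
  have "(a - b) * s * p - s * p * a * d = s * p * ((a - b) - a * d)"
    by (simp add: algebra_simps)
  then have c7: "(a - b) * s * p - s * p * a * d = 0"
    by (simp add: assms(1) aB ad)
  show "(s * (q - p) * b * B - a * B * B) *\<^sub>F (x * x) +
    (s * q * b * d - a * B * d - b * d * s * p) *\<^sub>F (x * w) +
    (b * d * s * q - a * B * d - s * p * d * b) *\<^sub>F (w * x) +
    (a - b - b * d - a * d * d) *\<^sub>F (w * w) +
    (s * q * a * B - b * s * q) *\<^sub>F (z * x) + (b * s * p - s * p * a * B) *\<^sub>F (x * z) +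
    (s * q * a * d - (a - b) * s * q) *\<^sub>F (z * w) +
    ((a - b) * s * p - s * p * a * d) *\<^sub>F (w * z) = 0"
    by (simp only: c0 c1 c2 c3 c4 c5 c6 c7 ncpoly.scale_zero_left add_0)
qed

text \<open>The relator without A becomes a multiple of the one relator without z; the coefficient
  of \<open>w * w\<close> gives the factor.\<close>

lemma xXA_relation_3:
  fixes x w :: "('k::field, 'g) ncpoly"
  assumes "s * (q - p) = 1" and "a * b = 1" and "B = b ^ 2" and "d = 1 - b ^ 2"
  shows "b *\<^sub>F x ^ 2 - ((b * q - a * p) * s) *\<^sub>F (x * (B *\<^sub>F x + d *\<^sub>F w)) -
      ((a * q - b * p) * s) *\<^sub>F ((B *\<^sub>F x + d *\<^sub>F w) * x) +
      a *\<^sub>F (B *\<^sub>F x + d *\<^sub>F w) ^ 2 =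
    (- (a * d * d)) *\<^sub>F (s *\<^sub>F (q *\<^sub>F (w * x) - p *\<^sub>F (x * w)) - w ^ 2)"
proof (rule equal_by_coefficients)
  show "b *\<^sub>F x ^ 2 - ((b * q - a * p) * s) *\<^sub>F (x * (B *\<^sub>F x + d *\<^sub>F w)) -
      ((a * q - b * p) * s) *\<^sub>F ((B *\<^sub>F x + d *\<^sub>F w) * x) +
      a *\<^sub>F (B *\<^sub>F x + d *\<^sub>F w) ^ 2 -
    (- (a * d * d)) *\<^sub>F (s *\<^sub>F (q *\<^sub>F (w * x) - p *\<^sub>F (x * w)) - w ^ 2) =
    (b - (b * q - a * p) * s * B - (a * q - b * p) * s * B + a * B * B) *\<^sub>F (x * x) +
    (a * B * d - (b * q - a * p) * s * d - a * d * d * s * p) *\<^sub>F (x * w) +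
    (a * B * d - (a * q - b * p) * s * d + a * d * d * s * q) *\<^sub>F (w * x)"
    by (simp add: algebra_simps power2_eq_square)
  have aB: "a * B = b" using assms(2,3) by (simp add: power2_eq_square flip: mult.assoc)
  have ad: "a * d = a - b" using aB assms(3,4) by (simp add: right_diff_distrib)
  have "b - (b * q - a * p) * s * B - (a * q - b * p) * s * B + a * B * B = b - (b * B + a * B) * (s * (q - p)) + a * B * B"
    by (simp add: algebra_simps)
  then have c0: "b - (b * q - a * p) * s * B - (a * q - b * p) * s * B + a * B * B = 0"
    by (simp add: assms(1) aB ad)
  have "a * B * d - (b * q - a * p) * s * d - a * d * d * s * p = a * B * d - b * d * (s * (q - p)) + (a - b) * d * s * p - a * d * d * s * p"
    by (simp add: algebra_simps)
  then have c1: "a * B * d - (b * q - a * p) * s * d - a * d * d * s * p = 0"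
    by (simp add: assms(1) aB ad)
  have "a * B * d - (a * q - b * p) * s * d + a * d * d * s * q = a * B * d - b * d * (s * (q - p)) - (a - b) * d * s * q + a * d * d * s * q"
    by (simp add: algebra_simps)
  then have c2: "a * B * d - (a * q - b * p) * s * d + a * d * d * s * q = 0"
    by (simp add: assms(1) aB ad)
  show "(b - (b * q - a * p) * s * B - (a * q - b * p) * s * B + a * B * B) *\<^sub>F (x * x) +
    (a * B * d - (b * q - a * p) * s * d - a * d * d * s * p) *\<^sub>F (x * w) +
    (a * B * d - (a * q - b * p) * s * d + a * d * d * s * q) *\<^sub>F (w * x) = 0"
    by (simp only: c0 c1 c2 ncpoly.scale_zero_left add_0)
qed

text \<open>The \<open>x * x\<close> terms cancel because \<open>s * (q - p) = 1\<close>, leaving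
  the relator in z and x.\<close>

lemma xXA_relation_1:
  fixes x z :: "('k::field, 'g) ncpoly"
  assumes "s * (q - p) = 1"
  shows "s *\<^sub>F (q *\<^sub>F ((b *\<^sub>F x + a *\<^sub>F z) * x) - p *\<^sub>F (x * (b *\<^sub>F x + a *\<^sub>F z))) - (b *\<^sub>F x ^ 2 + a *\<^sub>F 1) =
    a *\<^sub>F (s *\<^sub>F (q *\<^sub>F (z * x) - p *\<^sub>F (x * z)) - 1)"
proof (rule equal_by_coefficients)
  show "s *\<^sub>F (q *\<^sub>F ((b *\<^sub>F x + a *\<^sub>F z) * x) - p *\<^sub>F (x * (b *\<^sub>F x + a *\<^sub>F z))) - (b *\<^sub>F x ^ 2 + a *\<^sub>F 1) -
    a *\<^sub>F (s *\<^sub>F (q *\<^sub>F (z * x) - p *\<^sub>F (x * z)) - 1) = (s * (q - p) * b - b) *\<^sub>F (x * x)"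
    by (simp add: algebra_simps power2_eq_square)
  show "(s * (q - p) * b - b) *\<^sub>F (x * x) = 0" using assms by simp
qed

text \<open>After substitution, the two families of relators are related by a triangular linear
  system with nonzero pivots, so each relator of one family lies in the ideal generated by the
  other.\<close>

lemma maps_relations_to_vee:
  fixes q a :: "'k::field"
  assumes "q - inverse q \<noteq> 0" and "a \<noteq> 0" and "a ^ 2 \<noteq> 1"
  shows "maps_relations (xXA_rels q a) (vee_rels q) (to_vee a)"
    and "maps_relations (vee_rels q) (xXA_rels q a) (from_vee a)"
proof -
  let ?IV = "relation_ideal (vee_rels q)" and ?IP = "relation_ideal (xXA_rels q a)"
  let ?to = "subst (to_vee a)" and ?from = "subst (from_vee a)"
  define s b where "s = 1 / (q - inverse q)" and "b = inverse a"
  have s: "s * (q - inverse q) = 1" and ab: "a * b = 1" "b * a = 1"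
    using assms by (simp_all add: s_def b_def)
  define v1 where "v1 = qcomm q (var Vyinv) (var Vx) - var Vyinv ^ 2"
  define v2 where "v2 = qcomm q (var Vz) (var Vyinv) - var Vyinv ^ 2"
  define v3 where "v3 = qcomm q (var Vz) (var Vx) - (1 :: ('k, vee_gen) ncpoly)"
  define w1 where "w1 = qcomm q (var WA) (var Wx) - (inverse a *\<^sub>F (var Wx ^ 2) + a *\<^sub>F 1)"
  define w2 where "w2 = qcomm q (var WA) (var WX) - (a *\<^sub>F (var WX ^ 2) + inverse a *\<^sub>F 1)"
  define w3 where "w3 = inverse a *\<^sub>F (var Wx ^ 2)
         - ((inverse a * q - a * inverse q) / (q - inverse q)) *\<^sub>F (var Wx * var WX)
         - ((a * q - inverse a * inverse q) / (q - inverse q)) *\<^sub>F (var WX * var Wx)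
         + a *\<^sub>F (var WX ^ 2)"
  have v: "v1 \<in> ?IV" "v2 \<in> ?IV" "v3 \<in> ?IV"
    unfolding v1_def v2_def v3_def by (rule relation_idealI, simp add: vee_rels_def)+
  have "w3 - 0 \<in> ?IP" unfolding w3_def by (rule relation_idealI) (simp add: xXA_rels_def)
  moreover have "w1 \<in> ?IP" "w2 \<in> ?IP"
    unfolding w1_def w2_def by (rule relation_idealI, simp add: xXA_rels_def)+
  ultimately have w: "w1 \<in> ?IP" "w2 \<in> ?IP" "w3 \<in> ?IP" by simp_all
  have to1: "?to w1 = a *\<^sub>F v3"
    using xXA_relation_1[OF s, of b "var Vx" a "var Vz"]
    by (simp add: w1_def v3_def qcomm_def s_def b_def)
  have to2: "?to w2 = b *\<^sub>F v3 + (a - b) *\<^sub>F v2 - (b * (1 - b ^ 2)) *\<^sub>F v1"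
    using xXA_relation_2[OF s ab(1) refl refl, of "var Vx" "var Vz" "var Vyinv"]
    by (simp only: w2_def v1_def v2_def v3_def qcomm_def s_def b_def subst_simps subst_mult
        subst_power to_vee.simps)
  have to3: "?to w3 = (- (a * (1 - b ^ 2) * (1 - b ^ 2))) *\<^sub>F v1"
    using xXA_relation_3[OF s ab(1) refl refl, of "var Vx" "var Vyinv"]
    by (simp only: w3_def v1_def qcomm_def s_def b_def subst_simps subst_mult
        subst_power to_vee.simps times_divide_eq_right mult_1_right)
  have "?to w1 \<in> ?IV" "?to w2 \<in> ?IV" "?to w3 \<in> ?IV"
    unfolding to1 to2 to3 by (intro relation_ideal_closed v)+
  then show "maps_relations (xXA_rels q a) (vee_rels q) (to_vee a)"
    by (simp add: maps_relations_def xXA_rels_def w1_def w2_def w3_def)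
  \<comment> \<open>Applying the inverse substitution to \<open>to1\<close>, \<open>to2\<close>,
    \<open>to3\<close> gives equations for the images of \<open>v1\<close>, \<open>v2\<close>,
    \<open>v3\<close>. They are solved in the order \<open>v3\<close>, \<open>v1\<close>,
    \<open>v2\<close>, with pivots \<open>a\<close>, \<open>?c\<close>,
    \<open>a - b\<close>.\<close>
  have from_to: "?from (?to p) = p" for p
    using assms(2,3) by (simp add: subst_subst subst_from_to subst_var)
  have a2: "a - b \<noteq> 0" unfolding b_def using assms(2,3) by (rule inverse_neq_self)
  then have b2: "1 - b ^ 2 \<noteq> 0"
    using ab by (metis eq_iff_diff_eq_0 mult_1_right mult.assoc power2_eq_square)
  have "a *\<^sub>F ?from v3 = w1" using from_to[of w1] by (simp only: to1 subst_simps)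
  then have "?from v3 = b *\<^sub>F w1" using ab by (metis ncpoly.scale_scale ncpoly.scale_one)
  then have 3: "?from v3 \<in> ?IP" by (simp add: relation_ideal_closed w)
  let ?c = "- (a * (1 - b ^ 2) * (1 - b ^ 2))"
  have "?c *\<^sub>F ?from v1 = w3" using from_to[of w3] by (simp only: to3 subst_simps)
  moreover have "?c \<noteq> 0" using b2 assms(2) by simp
  ultimately have "?from v1 = inverse ?c *\<^sub>F w3"
    by (metis ncpoly.scale_scale ncpoly.scale_one left_inverse)
  then have 1: "?from v1 \<in> ?IP" by (simp only: relation_ideal_closed w)
  have "b *\<^sub>F ?from v3 + (a - b) *\<^sub>F ?from v2 - (b * (1 - b ^ 2)) *\<^sub>F ?from v1 = w2"
    using from_to[of w2] by (simp only: to2 subst_simps)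
  then have "(a - b) *\<^sub>F ?from v2 = w2 - b *\<^sub>F ?from v3 + (b * (1 - b ^ 2)) *\<^sub>F ?from v1"
    by (simp add: algebra_simps)
  then have "?from v2 = inverse (a - b) *\<^sub>F (w2 - b *\<^sub>F ?from v3 + (b * (1 - b ^ 2)) *\<^sub>F ?from v1)"
    using a2 by (metis ncpoly.scale_scale ncpoly.scale_one left_inverse)
  then have 2: "?from v2 \<in> ?IP" by (simp only: relation_ideal_closed w 1 3)
  show "maps_relations (vee_rels q) (xXA_rels q a) (from_vee a)"
    using 1 2 3 by (simp add: maps_relations_def vee_rels_def v1_def v2_def v3_def)
qed

section \<open>The subalgebra of the equitable presentation\<close>

fun vee_to_Uq :: "vee_gen \<Rightarrow> ('k::field, equitable_gen) ncpoly" where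
  "vee_to_Uq Vx = var Ux"
| "vee_to_Uq Vyinv = var Uyinv"
| "vee_to_Uq Vz = var Uz"

text \<open>The two relations with y become those with its inverse \<open>k\<close> after
  multiplication by \<open>k\<close> on both sides.\<close>

lemma maps_relations_vee_to_Uq:
  "maps_relations (vee_rels q) (Uq_rels q) (vee_to_Uq :: _ \<Rightarrow> ('k::field, _) ncpoly)"
proof -
  let ?I = "relation_ideal (Uq_rels q)"
  define x y k z :: "('k, equitable_gen) ncpoly"
    where "x = var Ux" and "y = var Uy" and "k = var Uyinv" and "z = var Uz"
  define p s where "p = inverse q" and "s = 1 / (q - inverse q)"
  note defs = x_def y_def k_def z_def
  have I: "y * k - 1 \<in> ?I" "k * y - 1 \<in> ?I" "qcomm q x y - 1 \<in> ?I" "qcomm q y z - 1 \<in> ?I"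
    "qcomm q z x - 1 \<in> ?I"
    unfolding defs by (rule relation_idealI, simp add: Uq_rels_def)+
  have qc: "qcomm q u v = s *\<^sub>F (q *\<^sub>F (u * v) - p *\<^sub>F (v * u))" for u v :: "('k, equitable_gen) ncpoly"
    by (simp add: qcomm_def s_def p_def)
  \<comment> \<open>The correction terms, which lie in the ideal, replace \<open>y * k\<close> and
    \<open>k * y\<close> by 1.\<close>
  have "qcomm q k x - k ^ 2 = k * (qcomm q x y - 1) * k -
      (s * q) *\<^sub>F (k * x * (y * k - 1)) + (s * p) *\<^sub>F ((k * y - 1) * x * k)"
    unfolding qc by (simp add: algebra_simps power2_eq_square)
  moreover have "qcomm q z k - k ^ 2 = k * (qcomm q y z - 1) * k -
      (s * q) *\<^sub>F ((k * y - 1) * z * k) + (s * p) *\<^sub>F (k * z * (y * k - 1))"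
    unfolding qc by (simp add: algebra_simps power2_eq_square)
  ultimately have "qcomm q k x - k ^ 2 \<in> ?I" "qcomm q z k - k ^ 2 \<in> ?I"
    by (simp_all only: relation_ideal_closed I)
  then show ?thesis
    using I(5) by (simp add: maps_relations_def vee_rels_def defs)
qed

locale equitable =
  fixes q :: "'k::field"
  assumes q_nonzero: "q \<noteq> 0" and q_diff: "q - inverse q \<noteq> 0"
begin

definition c :: 'k where "c = inverse q ^ 2"

lemma c_nonzero: "c \<noteq> 0"
  by (simp add: c_def q_nonzero)

subsection \<open>A representation on functions\<close>

text \<open>A function records the coefficients of the monomials \<open>e^i w^j f^l\<close>. The
  exponent j is an integer because y must act as the inverse of w. Supports may be infinite, since
  each value of an operator depends on finitely many values of its argument.\<close>

type_synonym 'f triples = "nat \<Rightarrow> int \<Rightarrow> nat \<Rightarrow> 'f"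

definition opE :: "'k triples \<Rightarrow> 'k triples" where
  "opE m = (\<lambda>i j l. case i of 0 \<Rightarrow> 0 | Suc i' \<Rightarrow> m i' j l)"

text \<open>Left multiplication by w: crossing \<open>e^i\<close> costs \<open>c ^ i\<close>, and
  the coefficient at j comes from \<open>j - 1\<close>.\<close>

definition opK :: "'k triples \<Rightarrow> 'k triples" where
  "opK m = (\<lambda>i j l. c ^ i * m i (j - 1) l)"

definition opY :: "'k triples \<Rightarrow> 'k triples" where
  "opY m = (\<lambda>i j l. inverse c ^ i * m i (j + 1) l)"

text \<open>Left multiplication by f. The first summand moves f past \<open>e^i w^j\<close>; the
  second collects the terms that \<open>f e\<close> produces, coming from index \<open>Suc i\<close>
  with w exponent \<open>j\<close> or \<open>j - 2\<close>.\<close>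

definition opF :: "'k triples \<Rightarrow> 'k triples" where
  "opF m = (\<lambda>i j l. (case l of 0 \<Rightarrow> 0 | Suc l' \<Rightarrow> c ^ i * c powi j * m i j l') +
     (1 - c ^ Suc i) * (m (Suc i) j l - c ^ i * m (Suc i) (j - 2) l))"

fun op :: "equitable_gen \<Rightarrow> 'k triples \<Rightarrow> 'k triples" where
  "op Ux m = opE m + opK m"
| "op Uy m = opY m"
| "op Uyinv m = opK m"
| "op Uz m = opF m + opK m"

definition scl :: "'k \<Rightarrow> 'k triples \<Rightarrow> 'k triples" where
  "scl d m = (\<lambda>i j l. d * m i j l)"

lemma scl_apply: "scl d m i j l = d * m i j l"
  by (simp add: scl_def)

lemma op_linear:
  "opE (m + n) = opE m + opE n" "opK (m + n) = opK m + opK n"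
  "opY (m + n) = opY m + opY n" "opF (m + n) = opF m + opF n"
  "opE (scl d m) = scl d (opE m)" "opK (scl d m) = scl d (opK m)"
  "opY (scl d m) = scl d (opY m)" "opF (scl d m) = scl d (opF m)"
  by (auto simp: fun_eq_iff scl_apply opE_def opK_def opY_def opF_def algebra_simps split: nat.split)

sublocale representation scl op
proof
  show "op g (m + n) = op g m + op g n" for g m n
    by (cases g) (simp_all add: op_linear)
  show "op g (scl d m) = scl d (op g m)" for g d m
    by (cases g) (simp_all add: op_linear fun_eq_iff scl_apply distrib_left)
qed (simp_all add: fun_eq_iff scl_apply algebra_simps)

text \<open>These are the invertibility of w, the normal-ordering rules for e, w, f, and the rules
  for y obtained by inverting w.\<close>

lemma op_relations:
  "opK (opY m) = m" "opY (opK m) = m"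
  "opK (opE m) = scl c (opE (opK m))" "opF (opK m) = scl c (opK (opF m))"
  "opF (opE m) = scl c (opE (opF m)) + scl (1 - c) (m - opK (opK m))"
  "opE (opY m) = scl c (opY (opE m))" "opY (opF m) = scl c (opF (opY m))"
proof -
  show "opK (opY m) = m" and "opY (opK m) = m" for m
    using c_nonzero by (auto simp: fun_eq_iff scl_apply opK_def opY_def power_inverse)
  show "opK (opE m) = scl c (opE (opK m))" for m
    by (auto simp: fun_eq_iff scl_apply opK_def opE_def split: nat.split)
  show "opF (opK m) = scl c (opK (opF m))" for m
    using c_nonzero
    by (auto simp: fun_eq_iff scl_apply opK_def opF_def power_int_diff field_simps split: nat.split)
  show "opF (opE m) = scl c (opE (opF m)) + scl (1 - c) (m - opK (opK m))" for m
  proof (intro ext)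
    fix i j l
    \<comment> \<open>The underlying identity is
      \<open>c * (1 - c ^ i) + (1 - c) = 1 - c ^ Suc i\<close>; at \<open>i = 0\<close> the values
      of \<open>opE\<close> are zero, hence the case split.\<close>
    show "opF (opE m) i j l = (scl c (opE (opF m)) + scl (1 - c) (m - opK (opK m))) i j l"
      by (cases i; cases l) (simp_all add: scl_apply opE_def opF_def opK_def algebra_simps)
  qed
  show "opE (opY m) = scl c (opY (opE m))"
    using c_nonzero by (auto simp: fun_eq_iff scl_apply opY_def opE_def split: nat.split)
  show "opY (opF m) = scl c (opF (opY m))"
    using c_nonzero
    by (auto simp: fun_eq_iff scl_apply opY_def opF_def power_int_add field_simps split: nat.split)
qed

text \<open>Polynomials that annihilate every vector form a two-sided ideal, so it suffices to check
  the five relators. The functions thus become a module over the equitable algebra.\<close>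

lemma act_relation_ideal:
  assumes "p \<in> relation_ideal (Uq_rels q)"
  shows "act p m = 0"
proof -
  \<comment> \<open>This turns \<open>q u v - inverse q v u\<close> into q times
    \<open>u v - c v u\<close>, to which \<open>op_relations\<close> applies.\<close>
  have qc: "inverse q = q * c" using q_nonzero by (simp add: c_def power2_eq_square)
  have *: "scl (1 / (q - inverse q)) (scl q u - scl (inverse q) v) = m"
    if "scl q u - scl (inverse q) v = scl (q - inverse q) m" for u v m
    unfolding that using q_diff by (simp add: scl_def)
  have "p \<in> {p. \<forall>m. act p m = 0}"
    using assms
  proof (rule relation_ideal_least)
    fix l r assume "(l, r) \<in> Uq_rels q"
    moreover have "act (qcomm q (var Ux) (var Uy)) m = m" for m
      unfolding qcomm_def act_scale act_diff act_mult act_var op.simps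
      by (rule *) (simp add: op_linear op_relations fun_eq_iff scl_apply qc algebra_simps)
    moreover have "act (qcomm q (var Uy) (var Uz)) m = m" for m
      unfolding qcomm_def act_scale act_diff act_mult act_var op.simps
      by (rule *) (simp add: op_linear op_relations fun_eq_iff scl_apply qc algebra_simps)
    moreover have "act (qcomm q (var Uz) (var Ux)) m = m" for m
      unfolding qcomm_def act_scale act_diff act_mult act_var op.simps
      by (rule *) (simp add: op_linear op_relations fun_eq_iff scl_apply qc algebra_simps)
    ultimately show "l - r \<in> {p. \<forall>m. act p m = 0}"
      by (auto simp: Uq_rels_def op_relations)
  qed auto
  then show ?thesis by simp
qed

subsection \<open>Normally ordered monomials\<close>

abbreviation vcls :: "('k, vee_gen) ncpoly \<Rightarrow> ('k, vee_gen) ncpoly set" where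
  "vcls \<equiv> cls (vee_rels q)"

definition w :: "('k, vee_gen) ncpoly" where "w = var Vyinv"
definition e :: "('k, vee_gen) ncpoly" where "e = var Vx - var Vyinv"
definition f :: "('k, vee_gen) ncpoly" where "f = var Vz - var Vyinv"

definition monomial :: "nat \<Rightarrow> nat \<Rightarrow> nat \<Rightarrow> ('k, vee_gen) ncpoly" where
  "monomial i j l = e ^ i * w ^ j * f ^ l"

text \<open>Put x = e + w and z = f + w in the relators: the squares of w cancel in the first two,
  and subtracting these from the third leaves the rule for \<open>f * e\<close>.\<close>

lemma ewf_relations:
  "vcls (w * e) = vcls (c *\<^sub>F (e * w))"
  "vcls (f * w) = vcls (c *\<^sub>F (w * f))"
  "vcls (f * e) = vcls (c *\<^sub>F (e * f) + (1 - c) *\<^sub>F (1 - w * w))"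
proof -
  define p s where "p = inverse q" and "s = 1 / (q - inverse q)"
  let ?I = "relation_ideal (vee_rels q)"
  \<comment> \<open>This factor inverts \<open>s * q\<close> and so clears the denominators:
    \<open>s (q u - p v)\<close> becomes \<open>u - c v\<close>. It equals \<open>1 - c\<close>, the
    scalar in the third rule.\<close>
  let ?t = "p * (q - p)"
  have pq: "p * q = 1" "p * p = c" and s: "s * (q - p) = 1"
    using q_nonzero q_diff unfolding p_def s_def c_def by (simp_all add: power2_eq_square)
  then have t: "?t = 1 - c" by (simp add: right_diff_distrib)
  have "?t * (s * u) = p * u * (s * (q - p))" for u by (simp add: mult_ac)
  then have ts: "?t * (s * q) = 1" "?t * (s * p) = c" by (simp_all only: s pq mult_1_right)
  have qc: "qcomm q u v = s *\<^sub>F (q *\<^sub>F (u * v) - p *\<^sub>F (v * u))" for u v :: "('k, vee_gen) ncpoly"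
    by (simp add: qcomm_def s_def p_def)
  have normalise: "?t *\<^sub>F (s *\<^sub>F (q *\<^sub>F u - p *\<^sub>F v)) = u - c *\<^sub>F v" for u v :: "('k, vee_gen) ncpoly"
    by (simp only: ncpoly.scale_right_diff_distrib ncpoly.scale_scale mult.assoc ts[unfolded mult.assoc] ncpoly.scale_one)
  \<comment> \<open>Taken at \<open>w * w\<close>, this says that the bracket of w with itself is
    its square.\<close>
  have self: "s *\<^sub>F (q *\<^sub>F u - p *\<^sub>F u) = u" for u :: "('k, vee_gen) ncpoly"
    proof -
    have "s *\<^sub>F (q *\<^sub>F u - p *\<^sub>F u) = (s * (q - p)) *\<^sub>F u"
      by (simp only: right_diff_distrib ncpoly.scale_left_diff_distrib ncpoly.scale_right_diff_distrib ncpoly.scale_scale)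
    then show ?thesis by (simp only: s ncpoly.scale_one)
  qed
  have x: "var Vx = e + w" and z: "var Vz = f + w" by (simp_all add: e_def f_def w_def)
  have "qcomm q w (e + w) - w ^ 2 \<in> ?I" "qcomm q (f + w) w - w ^ 2 \<in> ?I" "qcomm q (f + w) (e + w) - 1 \<in> ?I"
    unfolding x[symmetric] z[symmetric] unfolding w_def by (rule relation_idealI, simp add: vee_rels_def)+
  moreover have "qcomm q w (e + w) - w ^ 2 = s *\<^sub>F (q *\<^sub>F (w * e) - p *\<^sub>F (e * w))"
    using self[of "w * w"] by (simp add: qc algebra_simps power2_eq_square)
  moreover have "qcomm q (f + w) w - w ^ 2 = s *\<^sub>F (q *\<^sub>F (f * w) - p *\<^sub>F (w * f))"
    using self[of "w * w"] by (simp add: qc algebra_simps power2_eq_square)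
  moreover have "qcomm q (f + w) (e + w) - 1 = s *\<^sub>F (q *\<^sub>F (f * e) - p *\<^sub>F (e * f)) +
      s *\<^sub>F (q *\<^sub>F (w * e) - p *\<^sub>F (e * w)) + s *\<^sub>F (q *\<^sub>F (f * w) - p *\<^sub>F (w * f)) + w * w - 1"
    using self[of "w * w"] by (simp add: qc algebra_simps)
  ultimately have I: "s *\<^sub>F (q *\<^sub>F (w * e) - p *\<^sub>F (e * w)) \<in> ?I" "s *\<^sub>F (q *\<^sub>F (f * w) - p *\<^sub>F (w * f)) \<in> ?I"
    "s *\<^sub>F (q *\<^sub>F (f * e) - p *\<^sub>F (e * f)) + s *\<^sub>F (q *\<^sub>F (w * e) - p *\<^sub>F (e * w)) +
      s *\<^sub>F (q *\<^sub>F (f * w) - p *\<^sub>F (w * f)) + w * w - 1 \<in> ?I"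
    by simp_all
  show "vcls (w * e) = vcls (c *\<^sub>F (e * w))"
    using relation_ideal_scale[OF I(1), of ?t] unfolding cls_eq_iff normalise .
  show "vcls (f * w) = vcls (c *\<^sub>F (w * f))"
    using relation_ideal_scale[OF I(2), of ?t] unfolding cls_eq_iff normalise .
  have "s *\<^sub>F (q *\<^sub>F (f * e) - p *\<^sub>F (e * f)) + w * w - 1 \<in> ?I"
    using relation_ideal_diff[OF relation_ideal_diff[OF I(3) I(1)] I(2)] by (simp add: algebra_simps)
  from relation_ideal_scale[OF this, of ?t]
  have "(f * e - c *\<^sub>F (e * f)) + ?t *\<^sub>F (w * w - 1) \<in> ?I"
    by (simp only: add_diff_eq[symmetric] ncpoly.scale_right_distrib normalise)
  then show "vcls (f * e) = vcls (c *\<^sub>F (e * f) + (1 - c) *\<^sub>F (1 - w * w))"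
    unfolding cls_eq_iff t by (simp add: algebra_simps)
qed

lemma vcls_mult_left: "vcls p = vcls r \<Longrightarrow> vcls (u * p) = vcls (u * r)"
  by (rule cls_mult_cong) simp

lemma vcls_mult_right: "vcls p = vcls r \<Longrightarrow> vcls (p * u) = vcls (r * u)"
  by (rule cls_mult_cong) simp_all

lemma w_e_power: "vcls (w * e ^ i) = vcls (c ^ i *\<^sub>F (e ^ i * w))"
proof (induction i)
  case (Suc i)
  have "vcls (w * e ^ Suc i) = vcls ((w * e) * e ^ i)" by (simp add: mult.assoc)
  also have "\<dots> = vcls ((c *\<^sub>F (e * w)) * e ^ i)" by (intro vcls_mult_right ewf_relations)
  also have "\<dots> = vcls (c *\<^sub>F (e * (w * e ^ i)))" by (simp add: mult.assoc)
  also have "\<dots> = vcls (c *\<^sub>F (e * (c ^ i *\<^sub>F (e ^ i * w))))" by (intro cls_scale_cong vcls_mult_left Suc)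
  finally show ?case by (simp add: mult.assoc)
qed simp

lemma f_w_power: "vcls (f * w ^ j) = vcls (c ^ j *\<^sub>F (w ^ j * f))"
proof (induction j)
  case (Suc i)
  have "vcls (f * w ^ Suc i) = vcls ((f * w) * w ^ i)" by (simp add: mult.assoc)
  also have "\<dots> = vcls ((c *\<^sub>F (w * f)) * w ^ i)" by (intro vcls_mult_right ewf_relations)
  also have "\<dots> = vcls (c *\<^sub>F (w * (f * w ^ i)))" by (simp add: mult.assoc)
  also have "\<dots> = vcls (c *\<^sub>F (w * (c ^ i *\<^sub>F (w ^ i * f))))" by (intro cls_scale_cong vcls_mult_left Suc)
  finally show ?case by (simp add: mult.assoc)
qed simp

text \<open>For \<open>i = 0\<close> the truncated exponents \<open>i - 1\<close> are harmless because of the factor \<open>1 - c ^ i\<close>.\<close>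

lemma f_e_power:
  "vcls (f * e ^ i) = vcls (c ^ i *\<^sub>F (e ^ i * f) +
     (1 - c ^ i) *\<^sub>F (e ^ (i - 1) - c ^ (i - 1) *\<^sub>F (e ^ (i - 1) * (w * w))))"
proof (induction i)
  case (Suc i)
  let ?r = "c ^ i *\<^sub>F (e ^ i * f) + (1 - c ^ i) *\<^sub>F (e ^ (i - 1) - c ^ (i - 1) *\<^sub>F (e ^ (i - 1) * (w * w)))"
  have ww: "vcls (w * w * e ^ i) = vcls ((c ^ i * c ^ i) *\<^sub>F (e ^ i * (w * w)))"
  proof -
    have "vcls (w * w * e ^ i) = vcls (w * (w * e ^ i))" by (simp add: mult.assoc)
    also have "\<dots> = vcls (w * (c ^ i *\<^sub>F (e ^ i * w)))" by (intro vcls_mult_left w_e_power)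
    also have "\<dots> = vcls (c ^ i *\<^sub>F ((w * e ^ i) * w))" by (simp add: mult.assoc)
    also have "\<dots> = vcls (c ^ i *\<^sub>F ((c ^ i *\<^sub>F (e ^ i * w)) * w))"
      by (intro cls_scale_cong vcls_mult_right w_e_power)
    finally show ?thesis by (simp add: mult.assoc)
  qed
  have "vcls (f * e ^ Suc i) = vcls ((f * e) * e ^ i)" by (simp add: mult.assoc)
  also have "\<dots> = vcls ((c *\<^sub>F (e * f) + (1 - c) *\<^sub>F (1 - w * w)) * e ^ i)"
    by (intro vcls_mult_right ewf_relations)
  also have "\<dots> = vcls (c *\<^sub>F (e * (f * e ^ i)) + (1 - c) *\<^sub>F (e ^ i - w * w * e ^ i))"
    by (simp add: distrib_right left_diff_distrib mult.assoc)
  also have "\<dots> = vcls (c *\<^sub>F (e * ?r) + (1 - c) *\<^sub>F (e ^ i - (c ^ i * c ^ i) *\<^sub>F (e ^ i * (w * w))))"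
    by (intro cls_add_cong cls_scale_cong vcls_mult_left cls_diff_cong refl Suc ww)
  also have "c *\<^sub>F (e * ?r) + (1 - c) *\<^sub>F (e ^ i - (c ^ i * c ^ i) *\<^sub>F (e ^ i * (w * w))) =
    c ^ Suc i *\<^sub>F (e ^ Suc i * f) + (1 - c ^ Suc i) *\<^sub>F (e ^ i - c ^ i *\<^sub>F (e ^ i * (w * w)))"
  \<comment> \<open>For positive i, \<open>e * e ^ (i - 1)\<close> is \<open>e ^ i\<close>; at
    \<open>i = 0\<close> this fails, but the coefficient \<open>1 - c ^ 0\<close> is zero.\<close>
  proof (cases i)
    case 0
    then show ?thesis by (simp add: algebra_simps)
  next
    case (Suc n)
    then show ?thesis by (simp add: algebra_simps)
  qed
  finally show ?case by simp
qed simp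

lemma w_monomial: "vcls (w * monomial i j l) = vcls (c ^ i *\<^sub>F monomial i (Suc j) l)"
proof -
  have "vcls (w * monomial i j l) = vcls ((w * e ^ i) * (w ^ j * f ^ l))"
    by (simp add: monomial_def mult.assoc)
  also have "\<dots> = vcls ((c ^ i *\<^sub>F (e ^ i * w)) * (w ^ j * f ^ l))"
    by (intro vcls_mult_right w_e_power)
  finally show ?thesis by (simp add: monomial_def mult.assoc)
qed

text \<open>Here f passes \<open>e ^ i\<close> by \<open>f_e_power\<close> and, in the leading term,
  passes \<open>w ^ j\<close> as well. The scalars are those of \<open>opF_basis\<close>, which
  keeps the two actions matched.\<close>

lemma f_monomial:
  "vcls (f * monomial i j l) = vcls ((c ^ i * c ^ j) *\<^sub>F monomial i j (Suc l) +
     (1 - c ^ i) *\<^sub>F (monomial (i - 1) j l - c ^ (i - 1) *\<^sub>F monomial (i - 1) (j + 2) l))"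
proof -
  let ?g = "(1 - c ^ i) *\<^sub>F (e ^ (i - 1) - c ^ (i - 1) *\<^sub>F (e ^ (i - 1) * (w * w)))"
  have "vcls (f * monomial i j l) = vcls ((f * e ^ i) * (w ^ j * f ^ l))"
    by (simp add: monomial_def mult.assoc)
  also have "\<dots> = vcls ((c ^ i *\<^sub>F (e ^ i * f) + ?g) * (w ^ j * f ^ l))"
    by (intro vcls_mult_right f_e_power)
  also have "\<dots> = vcls (c ^ i *\<^sub>F (e ^ i * ((f * w ^ j) * f ^ l)) + ?g * (w ^ j * f ^ l))"
    by (simp add: distrib_right mult.assoc)
  also have "\<dots> = vcls (c ^ i *\<^sub>F (e ^ i * ((c ^ j *\<^sub>F (w ^ j * f)) * f ^ l)) + ?g * (w ^ j * f ^ l))"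
    by (intro cls_add_cong cls_scale_cong vcls_mult_left vcls_mult_right f_w_power refl)
  finally show ?thesis
    by (simp add: monomial_def mult.assoc left_diff_distrib)
qed

subsection \<open>Linear independence\<close>

definition basis :: "nat \<Rightarrow> nat \<Rightarrow> nat \<Rightarrow> 'k triples" where
  "basis i j l = (\<lambda>i' j' l'. if i' = i \<and> j' = int j \<and> l' = l then 1 else 0)"

text \<open>Stability under the generators, which act on both components, puts every pair
  \<open>(p, p \<cdot> basis 0 0 0)\<close> in this relation; so spanning and independence of the monomials are
  obtained from a single induction.\<close>

inductive matches :: "('k, vee_gen) ncpoly \<Rightarrow> 'k triples \<Rightarrow> bool" where
  ideal: "p \<in> relation_ideal (vee_rels q) \<Longrightarrow> matches p 0"
| monomial: "matches (monomial i j l) (basis i j l)"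
| scale: "matches p m \<Longrightarrow> matches (d *\<^sub>F p) (scl d m)"
| add: "matches p m \<Longrightarrow> matches r n \<Longrightarrow> matches (p + r) (m + n)"

lemma matches_cong: "matches p m \<Longrightarrow> vcls r = vcls p \<Longrightarrow> matches r m"
  using matches.add[of p m "r - p" 0] by (simp add: cls_eq_iff matches.ideal)

lemma matches_diff: "matches p m \<Longrightarrow> matches r n \<Longrightarrow> matches (p - r) (m - n)"
proof -
  assume "matches p m" "matches r n"
  then have "matches (p + (- 1) *\<^sub>F r) (m + scl (- 1) n)" by (intro matches.intros)
  moreover have "m + scl (- 1) n = m - n" by (simp add: fun_eq_iff scl_apply)
  ultimately show ?thesis by simp
qed

text \<open>The counterpart of \<open>f_monomial\<close> for basis vectors; at \<open>i = 0\<close>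
  the truncated index \<open>i - 1\<close> comes with coefficient zero.\<close>

lemma opF_basis:
  "opF (basis i j l) = scl (c ^ i * c ^ j) (basis i j (Suc l)) +
     scl (1 - c ^ i) (basis (i - 1) j l - scl (c ^ (i - 1)) (basis (i - 1) (j + 2) l))"
  by (cases i) (auto simp: fun_eq_iff scl_apply opF_def basis_def split: nat.split)

text \<open>Induction on \<open>matches\<close>: on monomials both components expand by the same
  formula, and the other cases are linearity and the ideal property.\<close>

lemma matches_generators:
  assumes "matches p m"
  shows "matches (e * p) (opE m)" and "matches (w * p) (opK m)" and "matches (f * p) (opF m)"
proof -
  have zero: "opE 0 = 0" "opK 0 = 0" "opF 0 = 0"
    by (auto simp: fun_eq_iff scl_apply opE_def opK_def opF_def split: nat.split)
  have "matches (e * p) (opE m) \<and> matches (w * p) (opK m) \<and> matches (f * p) (opF m)"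
    using assms
  proof induction
    case (ideal p)
    then show ?case unfolding zero by (intro conjI matches.ideal relation_ideal_mult_left)
  next
    case (monomial i j l)
    have "opE (basis i j l) = basis (Suc i) j l"
      by (auto simp: fun_eq_iff scl_apply opE_def basis_def split: nat.split)
    moreover have "e * monomial i j l = monomial (Suc i) j l"
      by (simp add: monomial_def mult.assoc)
    ultimately have "matches (e * monomial i j l) (opE (basis i j l))"
      by (simp add: matches.monomial)
    moreover have "opK (basis i j l) = scl (c ^ i) (basis i (Suc j) l)"
      by (auto simp: fun_eq_iff scl_apply opK_def basis_def)
    then have "matches (w * monomial i j l) (opK (basis i j l))"
      by (simp only:) (rule matches_cong[OF _ w_monomial], intro matches.intros)
    moreover have "matches (f * monomial i j l) (opF (basis i j l))"
      unfolding opF_basis by (rule matches_cong[OF _ f_monomial]) (intro matches.intros matches_diff)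
    ultimately show ?case by blast
  next
    case (scale p m d)
    then show ?case by (simp add: op_linear matches.scale)
  next
    case (add p m r n)
    then show ?case by (simp add: op_linear matches.add distrib_left del: plus_fun_apply)
  qed
  then show "matches (e * p) (opE m)" and "matches (w * p) (opK m)" and "matches (f * p) (opF m)"
    by blast+
qed

lemma matches_act: "matches p (act (subst vee_to_Uq p) (basis 0 0 0))"
proof (induction p rule: ncpoly_induct)
  case one
  then show ?case using matches.monomial[of 0 0 0] by (simp add: monomial_def)
next
  case (var g p)
  let ?m = "act (subst vee_to_Uq p) (basis 0 0 0)"
  \<comment> \<open>The same decomposition defines \<open>op\<close>: x acts as e plus w, and z as f
    plus w.\<close>
  have "var Vx = e + w" "var Vyinv = w" "var Vz = f + w"
    by (simp_all add: e_def f_def w_def)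
  then have "var g * p = (case g of Vx \<Rightarrow> e * p + w * p | Vyinv \<Rightarrow> w * p | Vz \<Rightarrow> f * p + w * p)"
    by (simp add: distrib_right split: vee_gen.split)
  moreover have "act (subst vee_to_Uq (var g * p)) (basis 0 0 0) =
      (case g of Vx \<Rightarrow> opE ?m + opK ?m | Vyinv \<Rightarrow> opK ?m | Vz \<Rightarrow> opF ?m + opK ?m)"
    by (simp del: plus_fun_apply split: vee_gen.split)
  ultimately show ?case
    using matches_generators[OF var]
    by (simp del: plus_fun_apply split: vee_gen.split add: matches.add)
qed (simp_all add: matches.intros del: plus_fun_apply)

text \<open>For fixed \<open>A\<close>, a linear map in \<open>m\<close> that takes
  \<open>basis i j l\<close> back to \<open>monomial i j l\<close> when \<open>A\<close> holds the
  support. Negative j receive exponent 0 from \<open>nat\<close>, which affects neither linearity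
  nor these values.\<close>

definition combination :: "(nat \<times> int \<times> nat) set \<Rightarrow> 'k triples \<Rightarrow> ('k, vee_gen) ncpoly" where
  "combination A m = (\<Sum>(i, j, l)\<in>A. m i j l *\<^sub>F monomial i (nat j) l)"

text \<open>Allows the supports of two summands to be placed in their union.\<close>

lemma combination_superset:
  assumes "finite B" and "A \<subseteq> B" and "\<And>i j l. m i j l \<noteq> 0 \<Longrightarrow> (i, j, l) \<in> A"
  shows "combination B m = combination A m"
proof -
  have "m i j l = 0" if "(i, j, l) \<notin> A" for i j l
    using assms(3) that by blast
  then show ?thesis
    unfolding combination_def using assms(1,2) by (intro sum.mono_neutral_right) auto
qed

text \<open>The key to independence: modulo the relations, \<open>p\<close> is recovered from the
  vector it matches, so matching 0 forces \<open>p\<close> into the ideal.\<close>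

lemma matches_combination:
  assumes "matches p m"
  shows "\<exists>A. finite A \<and> (\<forall>i j l. m i j l \<noteq> 0 \<longrightarrow> (i, j, l) \<in> A) \<and> vcls p = vcls (combination A m)"
  using assms
proof induction
  case (ideal p)
  then show ?case by (intro exI[of _ "{}"]) (simp add: combination_def cls_eq_iff)
next
  case (monomial i j l)
  then show ?case by (intro exI[of _ "{(i, int j, l)}"]) (simp add: combination_def basis_def)
next
  case (scale p m d)
  then obtain A where A: "finite A" "\<forall>i j l. m i j l \<noteq> 0 \<longrightarrow> (i, j, l) \<in> A" "vcls p = vcls (combination A m)"
    by blast
  have "combination A (scl d m) = d *\<^sub>F combination A m"
    by (simp add: combination_def scl_apply ncpoly.scale_sum_right case_prod_unfold)
  then have "vcls (d *\<^sub>F p) = vcls (combination A (scl d m))"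
    using cls_scale_cong[OF A(3)] by simp
  moreover have "\<forall>i j l. scl d m i j l \<noteq> 0 \<longrightarrow> (i, j, l) \<in> A"
    using A(2) by (simp add: scl_apply)
  ultimately show ?case using A(1) by blast
next
  case (add p m r n)
  then obtain A B where A: "finite A" "\<forall>i j l. m i j l \<noteq> 0 \<longrightarrow> (i, j, l) \<in> A" "vcls p = vcls (combination A m)"
    and B: "finite B" "\<forall>i j l. n i j l \<noteq> 0 \<longrightarrow> (i, j, l) \<in> B" "vcls r = vcls (combination B n)"
    by blast
  have "combination (A \<union> B) (m + n) = combination (A \<union> B) m + combination (A \<union> B) n"
    by (simp add: combination_def ncpoly.scale_left_distrib sum.distrib case_prod_unfold)
  also have "\<dots> = combination A m + combination B n"
    using combination_superset[of "A \<union> B" A m] combination_superset[of "A \<union> B" B n] A B by auto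
  finally have "vcls (p + r) = vcls (combination (A \<union> B) (m + n))"
    using cls_add_cong[OF A(3) B(3)] by simp
  moreover have "\<forall>i j l. (m + n) i j l \<noteq> 0 \<longrightarrow> (i, j, l) \<in> A \<union> B"
    using A(2) B(2) by (metis UnCI add_0 plus_fun_apply)
  ultimately show ?case using A(1) B(1) by blast
qed

text \<open>If the image of \<open>p\<close> is zero in the equitable algebra, it sends
  \<open>basis 0 0 0\<close> to 0; hence \<open>p\<close> matches 0 and equals a combination with
  zero coefficients.\<close>

lemma vee_to_Uq_injective:
  assumes "subst vee_to_Uq p \<in> relation_ideal (Uq_rels q)"
  shows "p \<in> relation_ideal (vee_rels q)"
proof -
  have "matches p 0" using matches_act[of p] act_relation_ideal[OF assms] by simp
  from matches_combination[OF this] have "vcls p = vcls 0" by (auto simp: combination_def)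
  then show ?thesis by (simp add: cls_eq_iff)
qed

section \<open>The subalgebra and its presentation\<close>

lemma range_vee_gen: "range (h :: vee_gen \<Rightarrow> 'a) = {h Vx, h Vyinv, h Vz}"
  by (auto intro: vee_gen.exhaust) (metis vee_gen.exhaust)

lemma Uq_vee_eq:
  "Uq_vee q = presented_algebra (Uq_rels q)\<lparr>carrier := range (\<lambda>p. cls (Uq_rels q) (subst vee_to_Uq p))\<rparr>"
  unfolding Uq_vee_def Uq_def
  by (rule generated_subalgebra_presented) (auto simp: range_vee_gen gen_eq_cls)

lemma Uq_vee_iso: "lift (Uq_rels q) vee_to_Uq \<in> alg_iso (presented_algebra (vee_rels q)) (Uq_vee q)"
  unfolding Uq_vee_eq
  by (rule lift_alg_iso[OF maps_relations_vee_to_Uq vee_to_Uq_injective refl])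

end

theorem theorem10p18:
  fixes q a :: "'k::field"
  assumes "q \<noteq> 0" and "q ^ 4 \<noteq> 1" and "a \<noteq> 0" and "a ^ 2 \<noteq> 1"
  defines "P \<equiv> presented_algebra (xXA_rels q a)"
    and "V \<equiv> presented_algebra (vee_rels q)"
    and "px \<equiv> gen (xXA_rels q a) Wx"
    and "pX \<equiv> gen (xXA_rels q a) WX"
    and "pA \<equiv> gen (xXA_rels q a) WA"
    and "vx \<equiv> gen (vee_rels q) Vx"
    and "vyinv \<equiv> gen (vee_rels q) Vyinv"
    and "vz \<equiv> gen (vee_rels q) Vz"
  shows "has_presentation (Uq_vee q) (xXA_elem q a) (xXA_rels q a) \<and>
    has_presentation (Uq_vee q) (vee_elem q) (vee_rels q) \<and>
    (\<exists>f g. f \<in> alg_iso P V \<and> g \<in> alg_iso V P \<and>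
       (\<forall>u\<in>carrier P. g (f u) = u) \<and> (\<forall>v\<in>carrier V. f (g v) = v) \<and>
       f px = vx \<and>
       f pX = (inverse a ^ 2 \<odot>\<^bsub>V\<^esub> vx) \<oplus>\<^bsub>V\<^esub> ((1 - inverse a ^ 2) \<odot>\<^bsub>V\<^esub> vyinv) \<and>
       f pA = (inverse a \<odot>\<^bsub>V\<^esub> vx) \<oplus>\<^bsub>V\<^esub> (a \<odot>\<^bsub>V\<^esub> vz) \<and>
       g vx = px \<and>
       g vyinv = (1 / (a - inverse a)) \<odot>\<^bsub>P\<^esub> ((a \<odot>\<^bsub>P\<^esub> pX) \<ominus>\<^bsub>P\<^esub> (inverse a \<odot>\<^bsub>P\<^esub> px)) \<and>
       g vz = (inverse a \<odot>\<^bsub>P\<^esub> pA) \<ominus>\<^bsub>P\<^esub> (inverse a ^ 2 \<odot>\<^bsub>P\<^esub> px))"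
proof -
  have "q ^ 2 \<noteq> 1"
    using assms(2) by (auto simp: power4_eq_xxxx power2_eq_square mult.assoc)
  with assms(1) have q: "q - inverse q \<noteq> 0" by (rule inverse_neq_self)
  interpret equitable q by unfold_locales fact+
  note to = maps_relations_to_vee(1)[OF q assms(3,4)]
    and from_vee = maps_relations_to_vee(2)[OF q assms(3,4)]
    and emb = maps_relations_vee_to_Uq[of q]
    and inv1 = subst_from_to[OF assms(3,4)] and inv2 = subst_to_from[OF assms(3,4)]
  let ?f = "lift (vee_rels q) (to_vee a)" and ?g = "lift (xXA_rels q a) (from_vee a)"
  let ?h = "lift (Uq_rels q) vee_to_Uq"
  have f: "?f \<in> alg_iso P V" and g: "?g \<in> alg_iso V P"
    unfolding P_def V_def
    by (rule lift_alg_iso_of_inverse[OF to from_vee inv1 inv2] lift_alg_iso_of_inverse[OF from_vee to inv2 inv1])+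
  have "?h (gen (vee_rels q) x) = vee_elem q x" for x
    by (cases x) (simp_all add: gen_eq_cls lift_cls[OF emb])
  then have vee: "has_presentation (Uq_vee q) (vee_elem q) (vee_rels q)"
    unfolding has_presentation_def using Uq_vee_iso by blast
  \<comment> \<open>The presentation by x, X, A is the change of variables followed by the
    isomorphism from the presentation by x, the inverse of y, and z onto the subalgebra.\<close>
  have "(?h \<circ> ?f) (gen (xXA_rels q a) x) = xXA_elem q a x" for x
    by (cases x) (simp_all add: gen_eq_cls lift_cls[OF emb] lift_cls[OF to] Uq_vee_eq presented_algebra_sel)
  moreover have "?h \<circ> ?f \<in> alg_iso (presented_algebra (xXA_rels q a)) (Uq_vee q)"
    using alg_iso_trans[OF f[unfolded P_def V_def] Uq_vee_iso] .
  ultimately have xXA: "has_presentation (Uq_vee q) (xXA_elem q a) (xXA_rels q a)"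
    unfolding has_presentation_def by blast
  have "?g (?f u) = u" if "u \<in> carrier P" for u
    using lift_mutual_inverse[OF to from_vee inv1 that[unfolded P_def]] .
  moreover have "?f (?g v) = v" if "v \<in> carrier V" for v
    using lift_mutual_inverse[OF from_vee to inv2 that[unfolded V_def]] .
  moreover have "?f px = vx" "?g vx = px"
    "?f pX = (inverse a ^ 2 \<odot>\<^bsub>V\<^esub> vx) \<oplus>\<^bsub>V\<^esub> ((1 - inverse a ^ 2) \<odot>\<^bsub>V\<^esub> vyinv)"
    "?f pA = (inverse a \<odot>\<^bsub>V\<^esub> vx) \<oplus>\<^bsub>V\<^esub> (a \<odot>\<^bsub>V\<^esub> vz)"
    "?g vyinv = (1 / (a - inverse a)) \<odot>\<^bsub>P\<^esub> ((a \<odot>\<^bsub>P\<^esub> pX) \<ominus>\<^bsub>P\<^esub> (inverse a \<odot>\<^bsub>P\<^esub> px))"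
    "?g vz = (inverse a \<odot>\<^bsub>P\<^esub> pA) \<ominus>\<^bsub>P\<^esub> (inverse a ^ 2 \<odot>\<^bsub>P\<^esub> px)"
    unfolding P_def V_def px_def pX_def pA_def vx_def vyinv_def vz_def
    by (simp_all add: gen_eq_cls lift_cls[OF to] lift_cls[OF from_vee] presented_algebra_sel
        presented_algebra_minus)
  ultimately show ?thesis using xXA vee f g by blast
qed

end
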